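(* Let $M$ be a connected closed $3$-dimensional manifold with a triangulation $\mathcal{T}=\{V,E,F,T\}$, let $\alpha\in\mathbb{R}$, and let $\overline{R}:V\to\mathbb{R}$ be a given function. (1) In the case of Euclidean background geometry: (a) if $\alpha\overline{R}\equiv 0$ on $V$, there exists, up to scaling, at most one Euclidean sphere packing metric on $(M,\mathcal{T})$ with combinatorial $\alpha$-curvature equal to $\overline{R}$ (i.e. any two such metrics $r,r'$ satisfy $r'=c\,r$ for some constant $c>0$); (b) if $\alpha\overline{R}_i\le 0$ for all $i\in V$ and $\alpha\overline{R}\not\equiv 0$, there exists at most one Euclidean sphere packing metric on $(M,\mathcal{T})$ with combinatorial $\alpha$-curvature equal to $\overline{R}$. (2) In the case of hyperbolic background geometry, if $\alpha\overline{R}_i\le 0$ for all $i\in V$, there exists at most one hyperbolic sphere packing metric on $(M,\mathcal{T})$ with combinatorial $\alpha$-curvature equal to $\overline{R}$.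
   Context: $V,E,F,T$ denote the (finite) sets of vertices, edges, faces and tetrahedra of the triangulation $\mathcal{T}$. A Euclidean (respectively hyperbolic) sphere packing metric on $(M,\mathcal{T})$ is a map $r:V\to(0,+\infty)$ such that, assigning to each edge $\{ij\}\in E$ the length $l_{ij}=r_i+r_j$, for each tetrahedron $\{i,j,k,l\}\in T$ the six numbers $l_{ij},l_{ik},l_{il},l_{jk},l_{jl},l_{kl}$ are the edge lengths of a nondegenerate Euclidean (respectively hyperbolic, curvature $-1$) tetrahedron. For a sphere packing metric $r$, the combinatorial scalar curvature $K:V\to\mathbb{R}$ is $$K_i=4\pi-\sum_{\{i,j,k,l\}\in T}\alpha_{ijkl},$$ where $\alpha_{ijkl}$ is the solid angle at the vertex $i$ of the (Euclidean, respectively hyperbolic) tetrahedron with vertices $i,j,k,l$ and the edge lengths above, and the sum is over all tetrahedra of $T$ having $i$ as a vertex. The solid angle at a vertex is the area of the corresponding spherical triangle on the unit sphere, i.e. the sum of the three dihedral angles at the edges meeting at that vertex minus $\pi$. For $\alpha\in\mathbb{R}$, the combinatorial $\alpha$-curvature of the sphere packing metric $r$ at a vertex $i\in V$ is $$R_{\alpha,i}=\frac{K_i}{s_i^{\alpha}},$$ where $s_i=r_i$ for Euclidean sphere packing metrics and $s_i=\tanh\frac{r_i}{2}$ for hyperbolic sphere packing metrics. "Combinatorial $\alpha$-curvature equal to $\overline{R}$" means $R_{\alpha,i}=\overline{R}_i$ for all $i\in V$. *)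

theory Defs
  imports "HOL-Analysis.Analysis"
begin

section \<open>Triangulated closed 3-manifolds\<close>

definition closed_connected_3_manifold :: "'m topology \<Rightarrow> bool" where
  "closed_connected_3_manifold M \<longleftrightarrow>
     Hausdorff_space M \<and> second_countable M \<and> compact_space M \<and> connected_space M \<and>
     (\<forall>x \<in> topspace M. \<exists>U W. openin M U \<and> x \<in> U \<and> open (W :: (real^3) set) \<and>
        subtopology M U homeomorphic_space top_of_set W)"

text \<open>The type variable of the ambient Euclidean space is arbitrary, and every finite
  simplicial complex is realised in some Euclidean space.\<close>

definition triangulates :: "'a::euclidean_space set set \<Rightarrow> 'm topology \<Rightarrow> bool" where
  "triangulates C M \<longleftrightarrow> simplicial_complex C \<and> top_of_set (\<Union>C) homeomorphic_space M"

definition vertices :: "'a::euclidean_space set set \<Rightarrow> 'a set" where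
  "vertices C = {v. {v} \<in> C}"

text \<open>A tetrahedron of \<open>C\<close> is represented by the set of its four vertices.\<close>

definition tetrahedra :: "'a::euclidean_space set set \<Rightarrow> 'a set set" where
  "tetrahedra C = {t. card t = 4 \<and> \<not> affine_dependent t \<and> convex hull t \<in> C}"


section \<open>Solid angles\<close>

text \<open>The form \<open>B\<close> is the inner product of the tangent space at the apex: the
  Euclidean one, or the Minkowski form, which is positive definite on the
  tangent spaces of the hyperboloid.\<close>

definition form_angle :: "('b::real_vector \<Rightarrow> 'b \<Rightarrow> real) \<Rightarrow> 'b \<Rightarrow> 'b \<Rightarrow> real" where
  "form_angle B v w = arccos (B v w / (sqrt (B v v) * sqrt (B w w)))"

definition orth_part :: "('b::real_vector \<Rightarrow> 'b \<Rightarrow> real) \<Rightarrow> 'b \<Rightarrow> 'b \<Rightarrow> 'b" where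
  "orth_part B u v = v - (B v u / B u u) *\<^sub>R u"

text \<open>Angle along the ray \<open>u\<close> between the half-planes through \<open>v\<close> and through \<open>w\<close>.\<close>

definition dihedral_angle :: "('b::real_vector \<Rightarrow> 'b \<Rightarrow> real) \<Rightarrow> 'b \<Rightarrow> 'b \<Rightarrow> 'b \<Rightarrow> real" where
  "dihedral_angle B u v w = form_angle B (orth_part B u v) (orth_part B u w)"

definition solid_angle :: "('b::real_vector \<Rightarrow> 'b \<Rightarrow> real) \<Rightarrow> 'b \<Rightarrow> 'b \<Rightarrow> 'b \<Rightarrow> real" where
  "solid_angle B u v w =
     dihedral_angle B u v w + dihedral_angle B v w u + dihedral_angle B w u v - pi"


section \<open>Euclidean and hyperbolic tetrahedra with prescribed edge lengths\<close>

definition euclidean_tetrahedron ::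
    "'v set \<Rightarrow> ('v \<Rightarrow> 'v \<Rightarrow> real) \<Rightarrow> ('v \<Rightarrow> real^3) \<Rightarrow> bool" where
  "euclidean_tetrahedron t len p \<longleftrightarrow>
     inj_on p t \<and> \<not> affine_dependent (p ` t) \<and>
     (\<forall>i\<in>t. \<forall>j\<in>t. i \<noteq> j \<longrightarrow> dist (p i) (p j) = len i j)"

text \<open>The solid angle at \<open>i\<close> does not depend on the placement \<open>p\<close> or on the order of the
  other three vertices; see \<open>euclidean_solid_angle_eq\<close> and
  \<open>hyperbolic_solid_angle_eq\<close> below.\<close>

definition euclidean_solid_angle :: "'v set \<Rightarrow> ('v \<Rightarrow> 'v \<Rightarrow> real) \<Rightarrow> 'v \<Rightarrow> real" where
  "euclidean_solid_angle t len i =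
     (THE \<theta>. \<exists>p j k l. euclidean_tetrahedron t len p \<and> t = {i, j, k, l} \<and> distinct [i, j, k, l] \<and>
        \<theta> = solid_angle (\<bullet>) (p j - p i) (p k - p i) (p l - p i))"

text \<open>Hyperbolic 3-space is the upper sheet of the hyperboloid in Minkowski space.\<close>

type_synonym minkowski = "(real^3) \<times> real"

definition mink :: "minkowski \<Rightarrow> minkowski \<Rightarrow> real" where
  "mink a b = fst a \<bullet> fst b - snd a * snd b"

definition hyperbolic_space :: "minkowski set" where
  "hyperbolic_space = {a. mink a a = -1 \<and> snd a > 0}"

definition hyperbolic_dist :: "minkowski \<Rightarrow> minkowski \<Rightarrow> real" where
  "hyperbolic_dist a b = arcosh (- mink a b)"

text \<open>Projection of \<open>b\<close> to the tangent space at \<open>a\<close>; it is a positive multiple of the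
  initial velocity of the geodesic from \<open>a\<close> to \<open>b\<close>.\<close>

definition hyperbolic_direction :: "minkowski \<Rightarrow> minkowski \<Rightarrow> minkowski" where
  "hyperbolic_direction a b = b + mink a b *\<^sub>R a"

text \<open>Hyperbolic planes are the intersections of the hyperboloid with linear hyperplanes,
  so nondegeneracy is linear independence of the four vertices.\<close>

definition hyperbolic_tetrahedron ::
    "'v set \<Rightarrow> ('v \<Rightarrow> 'v \<Rightarrow> real) \<Rightarrow> ('v \<Rightarrow> minkowski) \<Rightarrow> bool" where
  "hyperbolic_tetrahedron t len p \<longleftrightarrow>
     p ` t \<subseteq> hyperbolic_space \<and> inj_on p t \<and> independent (p ` t) \<and>
     (\<forall>i\<in>t. \<forall>j\<in>t. i \<noteq> j \<longrightarrow> hyperbolic_dist (p i) (p j) = len i j)"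

definition hyperbolic_solid_angle :: "'v set \<Rightarrow> ('v \<Rightarrow> 'v \<Rightarrow> real) \<Rightarrow> 'v \<Rightarrow> real" where
  "hyperbolic_solid_angle t len i =
     (THE \<theta>. \<exists>p j k l. hyperbolic_tetrahedron t len p \<and> t = {i, j, k, l} \<and> distinct [i, j, k, l] \<and>
        \<theta> = solid_angle mink (hyperbolic_direction (p i) (p j))
              (hyperbolic_direction (p i) (p k)) (hyperbolic_direction (p i) (p l)))"


section \<open>Sphere packing metrics and combinatorial curvatures\<close>

text \<open>A metric is a total function, of which only the values on the vertices matter.\<close>

definition edge_length :: "('v \<Rightarrow> real) \<Rightarrow> 'v \<Rightarrow> 'v \<Rightarrow> real" where
  "edge_length r i j = r i + r j"

definition euclidean_sphere_packing :: "'a::euclidean_space set set \<Rightarrow> ('a \<Rightarrow> real) \<Rightarrow> bool" where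
  "euclidean_sphere_packing C r \<longleftrightarrow>
     (\<forall>v \<in> vertices C. r v > 0) \<and>
     (\<forall>t \<in> tetrahedra C. \<exists>p. euclidean_tetrahedron t (edge_length r) p)"

definition hyperbolic_sphere_packing :: "'a::euclidean_space set set \<Rightarrow> ('a \<Rightarrow> real) \<Rightarrow> bool" where
  "hyperbolic_sphere_packing C r \<longleftrightarrow>
     (\<forall>v \<in> vertices C. r v > 0) \<and>
     (\<forall>t \<in> tetrahedra C. \<exists>p. hyperbolic_tetrahedron t (edge_length r) p)"

definition euclidean_curvature :: "'a::euclidean_space set set \<Rightarrow> ('a \<Rightarrow> real) \<Rightarrow> 'a \<Rightarrow> real" where
  "euclidean_curvature C r i =
     4 * pi - (\<Sum>t \<in> {t \<in> tetrahedra C. i \<in> t}. euclidean_solid_angle t (edge_length r) i)"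

definition hyperbolic_curvature :: "'a::euclidean_space set set \<Rightarrow> ('a \<Rightarrow> real) \<Rightarrow> 'a \<Rightarrow> real" where
  "hyperbolic_curvature C r i =
     4 * pi - (\<Sum>t \<in> {t \<in> tetrahedra C. i \<in> t}. hyperbolic_solid_angle t (edge_length r) i)"

definition euclidean_alpha_curvature ::
    "'a::euclidean_space set set \<Rightarrow> real \<Rightarrow> ('a \<Rightarrow> real) \<Rightarrow> 'a \<Rightarrow> real" where
  "euclidean_alpha_curvature C \<alpha> r i = euclidean_curvature C r i / r i powr \<alpha>"

definition hyperbolic_alpha_curvature ::
    "'a::euclidean_space set set \<Rightarrow> real \<Rightarrow> ('a \<Rightarrow> real) \<Rightarrow> 'a \<Rightarrow> real" where
  "hyperbolic_alpha_curvature C \<alpha> r i = hyperbolic_curvature C r i / tanh (r i / 2) powr \<alpha>"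


section \<open>The solid angles are well defined\<close>

definition gram_form :: "('b::real_vector \<Rightarrow> 'b \<Rightarrow> real) \<Rightarrow> bool" where
  "gram_form B \<longleftrightarrow> (\<forall>x y. B x y = B y x) \<and> (\<forall>x y z. B (x - y) z = B x z - B y z) \<and>
     (\<forall>c x y. B (c *\<^sub>R x) y = c * B x y)"

lemma gram_form_inner: "gram_form ((\<bullet>) :: 'b::real_inner \<Rightarrow> 'b \<Rightarrow> real)"
  unfolding gram_form_def by (intro conjI allI inner_commute inner_diff_left inner_scaleR_left)

lemma gram_form_mink: "gram_form mink"
  unfolding gram_form_def mink_def
  by (intro conjI allI) (simp_all add: inner_commute inner_diff_left inner_diff_right left_diff_distrib right_diff_distrib)

lemma orth_part_form:
  assumes "gram_form B"
  shows "B (orth_part B u v) (orth_part B u w) = B v w - B v u * B w u / B u u"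
proof -
  have s: "B x y = B y x" and d: "B (x - y) z = B x z - B y z"
    and m: "B (c *\<^sub>R x) y = c * B x y" for x y z c
    using assms by (auto simp: gram_form_def)
  have d': "B z (x - y) = B z x - B z y" and m': "B y (c *\<^sub>R x) = c * B y x" for x y z c
    by (metis s d) (metis s m)
  show ?thesis
    by (cases "B u u = 0") (simp_all add: orth_part_def d m d' m' s[of u v] s[of u w])
qed

lemma dihedral_angle_gram:
  assumes "gram_form B" "gram_form B'"
    and "B u u = B' u' u'" "B v v = B' v' v'" "B w w = B' w' w'"
    and "B u v = B' u' v'" "B u w = B' u' w'" "B v w = B' v' w'"
  shows "dihedral_angle B u v w = dihedral_angle B' u' v' w'"
proof -
  have "B v u = B' v' u'" "B w u = B' w' u'"
    using assms by (metis gram_form_def)+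
  then show ?thesis
    using assms by (simp add: dihedral_angle_def form_angle_def orth_part_form)
qed

lemma solid_angle_gram:
  assumes "gram_form B" "gram_form B'"
    and "B u u = B' u' u'" "B v v = B' v' v'" "B w w = B' w' w'"
    and "B u v = B' u' v'" "B u w = B' u' w'" "B v w = B' v' w'"
  shows "solid_angle B u v w = solid_angle B' u' v' w'"
proof -
  have "B v u = B' v' u'" "B w u = B' w' u'" "B w v = B' w' v'"
    using assms by (metis gram_form_def)+
  then show ?thesis
    using assms by (auto simp: solid_angle_def intro!: arg_cong2[where f = "(+)"] dihedral_angle_gram)
qed

lemma dihedral_angle_commute:
  assumes "gram_form B"
  shows "dihedral_angle B u v w = dihedral_angle B u w v"
  using assms by (simp add: dihedral_angle_def form_angle_def gram_form_def mult.commute)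

lemma solid_angle_perm:
  assumes "gram_form B" "{j, k, l} = {j', k', l'}" "distinct [j, k, l]" "distinct [j', k', l']"
  shows "solid_angle B (u j) (u k) (u l) = solid_angle B (u j') (u k') (u l')"
proof -
  note c = dihedral_angle_commute[OF assms(1)]
  have jkl: "(j' = j \<or> j' = k \<or> j' = l) \<and> (k' = j \<or> k' = k \<or> k' = l) \<and> (l' = j \<or> l' = k \<or> l' = l)"
    using assms(2) by blast
  have "solid_angle B x y z = solid_angle B y z x" "solid_angle B x y z = solid_angle B x z y" for x y z
    unfolding solid_angle_def using c[of x y z] c[of y z x] c[of z x y] by simp_all
  then show ?thesis
    using jkl assms(3,4) by auto
qed

lemma inner_from_dist:
  fixes a b c :: "'b::real_inner"
  shows "(b - a) \<bullet> (c - a) = ((dist a b)\<^sup>2 + (dist a c)\<^sup>2 - (dist b c)\<^sup>2) / 2"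
proof -
  have "b - c = (b - a) - (c - a)" by simp
  then have "(dist b c)\<^sup>2 = (norm (b - a))\<^sup>2 + (norm (c - a))\<^sup>2 - 2 * ((b - a) \<bullet> (c - a))"
    unfolding dist_norm power2_norm_eq_inner
    by (simp only: inner_diff_left[of "b - a" "c - a"] inner_diff_right[of _ "b - a" "c - a"]
        inner_commute[of "c - a" "b - a"])
  then show ?thesis
    by (simp add: dist_norm norm_minus_commute[of a])
qed

theorem euclidean_solid_angle_eq:
  assumes p: "euclidean_tetrahedron t len p" and t: "t = {i, j, k, l}" "distinct [i, j, k, l]"
  shows "euclidean_solid_angle t len i = solid_angle (\<bullet>) (p j - p i) (p k - p i) (p l - p i)"
  unfolding euclidean_solid_angle_def
proof (rule the_equality)
  show "\<exists>q j' k' l'. euclidean_tetrahedron t len q \<and> t = {i, j', k', l'} \<and>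
      distinct [i, j', k', l'] \<and>
      solid_angle (\<bullet>) (p j - p i) (p k - p i) (p l - p i) =
      solid_angle (\<bullet>) (q j' - q i) (q k' - q i) (q l' - q i)"
    using assms by blast
next
  fix \<theta>
  assume "\<exists>q j' k' l'. euclidean_tetrahedron t len q \<and> t = {i, j', k', l'} \<and>
      distinct [i, j', k', l'] \<and> \<theta> = solid_angle (\<bullet>) (q j' - q i) (q k' - q i) (q l' - q i)"
  then obtain q j' k' l' where q: "euclidean_tetrahedron t len q"
    and t': "t = {i, j', k', l'}" "distinct [i, j', k', l']"
    and \<theta>: "\<theta> = solid_angle (\<bullet>) (q j' - q i) (q k' - q i) (q l' - q i)"
    by blast
  have "{j', k', l'} = t - {i}" unfolding t'(1) using t'(2) by auto
  moreover have "{j, k, l} = t - {i}" unfolding t(1) using t(2) by auto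
  ultimately have "{j', k', l'} = {j, k, l}" by simp
  then have "\<theta> = solid_angle (\<bullet>) (q j - q i) (q k - q i) (q l - q i)"
    using solid_angle_perm[of "(\<bullet>)" j' k' l' j k l "\<lambda>x. q x - q i"] t(2) t'(2)
    by (simp add: \<theta> gram_form_inner)
  also have "\<dots> = solid_angle (\<bullet>) (p j - p i) (p k - p i) (p l - p i)"
  proof -
    have "dist (q x) (q y) = dist (p x) (p y)" if "x \<in> t" "y \<in> t" for x y
      using p q that by (cases "x = y") (auto simp: euclidean_tetrahedron_def)
    then show ?thesis
      by (intro solid_angle_gram gram_form_inner) (simp_all only: inner_from_dist t(1) insert_iff simp_thms)
  qed
  finally show "\<theta> = solid_angle (\<bullet>) (p j - p i) (p k - p i) (p l - p i)" .
qed

lemma mink_le: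
  assumes "a \<in> hyperbolic_space" "b \<in> hyperbolic_space"
  shows "- mink a b \<ge> 1"
proof -
  obtain x s where a: "a = (x, s)" by (cases a)
  obtain y u where b: "b = (y, u)" by (cases b)
  have s: "s\<^sup>2 = 1 + (norm x)\<^sup>2" "s > 0" and u: "u\<^sup>2 = 1 + (norm y)\<^sup>2" "u > 0"
    using assms unfolding a b hyperbolic_space_def mink_def
    by (auto simp: dot_square_norm power2_eq_square)
  have "(1 + norm x * norm y)\<^sup>2 \<le> (s * u)\<^sup>2"
  proof -
    have "(1 + (norm x)\<^sup>2) * (1 + (norm y)\<^sup>2) - (1 + norm x * norm y)\<^sup>2 = (norm x - norm y)\<^sup>2"
      by (simp add: power2_eq_square algebra_simps)
    then show ?thesis
      using zero_le_power2[of "norm x - norm y"] unfolding power_mult_distrib s u by linarith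
  qed
  then have "1 + norm x * norm y \<le> s * u"
    by (rule power2_le_imp_le) (use s(2) u(2) in simp)
  then show ?thesis
    using norm_cauchy_schwarz[of x y] by (simp add: a b mink_def)
qed

lemma mink_from_dist:
  assumes "a \<in> hyperbolic_space" "b \<in> hyperbolic_space"
  shows "mink a b = - cosh (hyperbolic_dist a b)"
  using mink_le[OF assms] by (simp add: hyperbolic_dist_def cosh_arcosh_real)

lemma mink_direction:
  assumes "a \<in> hyperbolic_space"
  shows "mink (hyperbolic_direction a b) (hyperbolic_direction a c) = mink b c + mink a b * mink a c"
proof -
  have "mink a a = -1" using assms by (simp add: hyperbolic_space_def)
  moreover have "mink (hyperbolic_direction a b) (hyperbolic_direction a c) =
      mink b c + 2 * mink a b * mink a c + mink a b * mink a c * mink a a"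
    by (simp add: hyperbolic_direction_def mink_def inner_add_left inner_add_right inner_commute
        algebra_simps)
  ultimately show ?thesis by (simp add: algebra_simps)
qed

theorem hyperbolic_solid_angle_eq:
  assumes p: "hyperbolic_tetrahedron t len p" and t: "t = {i, j, k, l}" "distinct [i, j, k, l]"
  shows "hyperbolic_solid_angle t len i =
    solid_angle mink (hyperbolic_direction (p i) (p j))
      (hyperbolic_direction (p i) (p k)) (hyperbolic_direction (p i) (p l))"
    (is "_ = ?S p j k l")
  unfolding hyperbolic_solid_angle_def
proof (rule the_equality)
  show "\<exists>q j' k' l'. hyperbolic_tetrahedron t len q \<and> t = {i, j', k', l'} \<and>
      distinct [i, j', k', l'] \<and> ?S p j k l = ?S q j' k' l'"
    using assms by blast
next
  fix \<theta>
  assume "\<exists>q j' k' l'. hyperbolic_tetrahedron t len q \<and> t = {i, j', k', l'} \<and>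
      distinct [i, j', k', l'] \<and> \<theta> = ?S q j' k' l'"
  then obtain q j' k' l' where q: "hyperbolic_tetrahedron t len q"
    and t': "t = {i, j', k', l'}" "distinct [i, j', k', l']" and \<theta>: "\<theta> = ?S q j' k' l'"
    by blast
  have "{j', k', l'} = t - {i}" unfolding t'(1) using t'(2) by auto
  moreover have "{j, k, l} = t - {i}" unfolding t(1) using t(2) by auto
  ultimately have "{j', k', l'} = {j, k, l}" by simp
  then have "\<theta> = ?S q j k l"
    using solid_angle_perm[of mink j' k' l' j k l "\<lambda>x. hyperbolic_direction (q i) (q x)"] t(2) t'(2)
    by (simp add: \<theta> gram_form_mink)
  also have "\<dots> = ?S p j k l"
  proof -
    have H: "p x \<in> hyperbolic_space" "q x \<in> hyperbolic_space" if "x \<in> t" for x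
      using p q that by (auto simp: hyperbolic_tetrahedron_def)
    have "mink (q x) (q y) = mink (p x) (p y)" if "x \<in> t" "y \<in> t" for x y
    proof (cases "x = y")
      case True
      then show ?thesis using H that by (auto simp: hyperbolic_space_def)
    next
      case False
      then show ?thesis
        using p q that H by (simp add: mink_from_dist hyperbolic_tetrahedron_def)
    qed
    then show ?thesis
      using H by (intro solid_angle_gram gram_form_mink) (simp_all add: mink_direction t(1))
  qed
  finally show "\<theta> = ?S p j k l" .
qed

end

theory Submission
  imports Defs
begin

text \<open>
  Put \<open>k\<^sub>i = 1 / r\<^sub>i\<close> (Euclidean case, \<open>e = 0\<close>) or \<open>k\<^sub>i = coth r\<^sub>i\<close> (hyperbolic case, \<open>e = 1\<close>), with
  sum \<open>\<sigma>\<close>, let \<open>s = e\<^sup>2 + (\<sigma>\<^sup>2 - 2 \<Sum> k\<^sub>i\<^sup>2) / 4\<close> and let \<open>\<phi>\<^sub>i\<close> be the argument of the point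
  \<open>(sqrt s, \<sigma> / 2 - k\<^sub>i)\<close> of the right half-plane.  The tetrahedron is nondegenerate only if \<open>s > 0\<close>, and its
  dihedral angle at the edge joining two vertices is the sum of the \<open>\<phi>\<close>'s of the other two vertices.  The
  angles \<open>\<phi>\<^sub>i\<close> make sense for all positive radii when \<open>s\<close> is replaced by \<open>max 0 s\<close>: this is a
  continuous extension of the solid angles which takes only finitely many values where \<open>s \<le> 0\<close>.

  Where \<open>s > 0\<close>, the Jacobian of the solid angles with respect to the radii is symmetric, and its kernel is
  spanned by \<open>r\<close> (Euclidean) or trivial (hyperbolic).  In the hyperbolic case, its signature is therefore constant
  along a path to four equal \<open>k\<^sub>i\<close>, where it is negative; the Euclidean case is a limit of the hyperbolic
  one.  Integrating along the segment from \<open>r\<close> to \<open>r'\<close>, which may leave the space of nondegenerate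
  tetrahedra, gives \<open>\<Sum> (\<alpha>\<^sub>i(r') - \<alpha>\<^sub>i(r)) (r'\<^sub>i - r\<^sub>i) \<le> 0\<close> on each tetrahedron, with equality only
  for proportional (equal) radii.  Summing over the tetrahedra and comparing with the sign of \<open>\<alpha> R\<close> forces
  equality in every tetrahedron, and the ratio \<open>r' / r\<close> propagates through shared vertices.
\<close>

section \<open>Angles of four mutually tangent spheres\<close>

text \<open>Unit normals of four mutually tangent spheres have Gram matrix \<open>2 I - J\<close> with respect to a Minkowski
  form, where \<open>J\<close> is the all-one matrix.  The value \<open>soddy e k\<close> is the Schur complement that arises when one adds
  a vector of square \<open>e\<^sup>2\<close> whose products with the normals are the numbers \<open>k\<^sub>i\<close>; here \<open>e\<^sup>2\<close> is minus
  the curvature of the ambient space.\<close>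

definition soddy :: "real \<Rightarrow> (4 \<Rightarrow> real) \<Rightarrow> real" where
  "soddy e k = e\<^sup>2 + ((\<Sum>i\<in>UNIV. k i)\<^sup>2 - 2 * (\<Sum>i\<in>UNIV. (k i)\<^sup>2)) / 4"

definition half_gap :: "(4 \<Rightarrow> real) \<Rightarrow> 4 \<Rightarrow> real" where
  "half_gap k i = (\<Sum>j\<in>UNIV. k j) / 2 - k i"

text \<open>\<open>Arg\<close> replaces \<open>arctan\<close> of the quotient because the real part
  may vanish; the argument extends continuously to such points of the imaginary axis other than
  zero.\<close>

definition half_angle :: "real \<Rightarrow> (4 \<Rightarrow> real) \<Rightarrow> 4 \<Rightarrow> real" where
  "half_angle e k i = Arg (Complex (sqrt (max 0 (soddy e k))) (half_gap k i))"

text \<open>This is the sum of three dihedral angles minus \<open>pi\<close>: the half-angle of each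
  vertex other than \<open>i\<close> enters the dihedral angles of two of the three edges at
  \<open>i\<close>.\<close>

definition vertex_angle :: "real \<Rightarrow> (4 \<Rightarrow> real) \<Rightarrow> 4 \<Rightarrow> real" where
  "vertex_angle e k i = 2 * ((\<Sum>j\<in>UNIV. half_angle e k j) - half_angle e k i) - pi"

text \<open>If \<open>k\<close> moves with velocity \<open>x\<close>, then \<open>half_angle\<close> moves with velocity
  \<open>angle_rate / (2 * sqrt soddy)\<close>.  In \<open>angle_form\<close> the velocity of \<open>k\<close> is the one caused by
  the velocity \<open>v\<close> of the radii.\<close>

definition angle_rate :: "real \<Rightarrow> (4 \<Rightarrow> real) \<Rightarrow> (4 \<Rightarrow> real) \<Rightarrow> 4 \<Rightarrow> real" where
  "angle_rate e k x i =
     (soddy e k * ((\<Sum>j\<in>UNIV. x j) - 2 * x i) - half_gap k i * (\<Sum>j\<in>UNIV. half_gap k j * x j))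
       / (soddy e k + (half_gap k i)\<^sup>2)"

definition angle_form :: "real \<Rightarrow> (4 \<Rightarrow> real) \<Rightarrow> (4 \<Rightarrow> real) \<Rightarrow> (4 \<Rightarrow> real) \<Rightarrow> real" where
  "angle_form e k v u =
     (\<Sum>i\<in>UNIV. angle_rate e k (\<lambda>j. - (((k j)\<^sup>2 - e\<^sup>2) * v j)) i * ((\<Sum>j\<in>UNIV. u j) - u i))"

lemma distinct_UNIV_4:
  assumes "distinct [i, j, a, b :: 4]"
  shows "UNIV = {i, j, a, b}"
  by (rule card_subset_eq[symmetric]) (use assms in auto)

lemma ex_distinct_4: "\<exists>j a b. distinct [i :: 4, j, a, b]"
proof -
  have "distinct [1, 2, 3, 4 :: 4]" "distinct [2, 1, 3, 4 :: 4]"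
    "distinct [3, 1, 2, 4 :: 4]" "distinct [4, 1, 2, 3 :: 4]"
    by simp_all
  then show ?thesis using exhaust_4[of i] by metis
qed

lemma soddy_diff_half_gap:
  assumes "distinct [i, j, a, b]"
  shows "soddy e k - half_gap k i * half_gap k j =
     e\<^sup>2 + (k i + k j) * (k a + k b) / 2 - ((k a)\<^sup>2 + (k b)\<^sup>2) / 2"
  using assms unfolding soddy_def half_gap_def distinct_UNIV_4[OF assms]
  by (simp add: power2_eq_square field_simps)

text \<open>Adding the square cancels every occurrence of \<open>k i\<close>. The result is positive
  for positive \<open>k\<close> even where \<open>soddy\<close> is negative, which keeps
  denominators and the argument of \<open>Arg\<close> away from zero.\<close>

lemma soddy_add_half_gap:
  assumes "distinct [i, j, a, b]"
  shows "soddy e k + (half_gap k i)\<^sup>2 = e\<^sup>2 + k j * k a + k j * k b + k a * k b"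
  using assms unfolding soddy_def half_gap_def distinct_UNIV_4[OF assms]
  by (simp add: power2_eq_square field_simps)

lemma soddy_half_gap_pos:
  assumes "\<And>j. k j > 0"
  shows "soddy e k + (half_gap k i)\<^sup>2 > 0"
proof -
  obtain j a b where d: "distinct [i, j, a, b]" using ex_distinct_4 by blast
  show ?thesis
    unfolding soddy_add_half_gap[OF d] using assms by (intro add_nonneg_pos add_pos_pos) auto
qed

section \<open>The linearised angles and the symmetry of their form\<close>

lemma angle_rate_apart:
  assumes "soddy e k + (half_gap k i)\<^sup>2 \<noteq> 0"
  shows "angle_rate e k x i =
    - x i + (\<Sum>j\<in>UNIV - {i}. (soddy e k - half_gap k i * half_gap k j) / (soddy e k + (half_gap k i)\<^sup>2) * x j)"
proof -
  let ?E = "soddy e k + (half_gap k i)\<^sup>2"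
  have "(\<Sum>j\<in>UNIV - {i}. (soddy e k - half_gap k i * half_gap k j) * x j) =
     (\<Sum>j\<in>UNIV. (soddy e k - half_gap k i * half_gap k j) * x j) - (soddy e k - (half_gap k i)\<^sup>2) * x i"
    using sum.remove[of UNIV i "\<lambda>j. (soddy e k - half_gap k i * half_gap k j) * x j"]
    by (simp add: power2_eq_square)
  also have "\<dots> = soddy e k * (\<Sum>j\<in>UNIV. x j) - half_gap k i * (\<Sum>j\<in>UNIV. half_gap k j * x j)
        - (soddy e k - (half_gap k i)\<^sup>2) * x i"
    by (simp add: left_diff_distrib sum_subtractf sum_distrib_left mult.assoc)
  finally have "soddy e k * ((\<Sum>j\<in>UNIV. x j) - 2 * x i) - half_gap k i * (\<Sum>j\<in>UNIV. half_gap k j * x j)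
     = - x i * ?E + (\<Sum>j\<in>UNIV - {i}. (soddy e k - half_gap k i * half_gap k j) * x j)"
    by (simp add: algebra_simps)
  then show ?thesis
    using assms by (simp only: angle_rate_def add_divide_distrib sum_divide_distrib times_divide_eq_left) simp
qed

text \<open>This is the symmetry of the Jacobian that the Schlaefli formula leads one to expect,
  proved by comparing coefficients; no sign of \<open>soddy\<close> is assumed.\<close>

lemma angle_form_commute:
  assumes "\<And>j. k j > 0"
  shows "angle_form e k v u = angle_form e k u v"
proof -
  note E = soddy_half_gap_pos[of k e, OF assms, THEN less_imp_neq, THEN not_sym]
  define w where "w j = (k j)\<^sup>2 - e\<^sup>2" for j
  define c where "c i j = (soddy e k - half_gap k i * half_gap k j) / (soddy e k + (half_gap k i)\<^sup>2)" for i j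
  have U: "UNIV - {1::4} = {2,3,4}" "UNIV - {2::4} = {1,3,4}" "UNIV - {3::4} = {1,2,4}" "UNIV - {4::4} = {1,2,3}"
    unfolding UNIV_4 by auto
  \<comment> \<open>The two sides are the coefficients of \<open>v m * u n\<close> and of
    \<open>v n * u m\<close> in \<open>angle_form e k v u\<close>.\<close>
  have key: "w m * (1 - c i m - c j m) = w n * (1 - c i n - c j n)" if "distinct [i, j, m, n]" for i j m n
  proof -
    have P: "e\<^sup>2 + k x * k y + k x * k z + k y * k z > 0" for x y z
      by (intro add_nonneg_pos add_pos_pos add_nonneg_nonneg mult_pos_pos mult_nonneg_nonneg) (auto simp: assms less_imp_le)
    define D where "D = e\<^sup>2 + k m * k n + k m * k j + k n * k j"
    define D' where "D' = e\<^sup>2 + k m * k n + k m * k i + k n * k i"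
    have D: "D \<noteq> 0" "D' \<noteq> 0" using P[of m n j] P[of m n i] unfolding D_def D'_def by auto
    have 1: "c i m = (e\<^sup>2 + (k i + k m) * (k n + k j) / 2 - ((k n)\<^sup>2 + (k j)\<^sup>2) / 2) / D"
      by (use that in \<open>auto simp: c_def soddy_diff_half_gap[of i m n j] soddy_add_half_gap[of i m n j] D_def algebra_simps\<close>)
    have 2: "c i n = (e\<^sup>2 + (k i + k n) * (k m + k j) / 2 - ((k m)\<^sup>2 + (k j)\<^sup>2) / 2) / D"
      by (use that in \<open>auto simp: c_def soddy_diff_half_gap[of i n m j] soddy_add_half_gap[of i n m j] D_def algebra_simps\<close>)
    have 3: "c j m = (e\<^sup>2 + (k j + k m) * (k n + k i) / 2 - ((k n)\<^sup>2 + (k i)\<^sup>2) / 2) / D'"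
      by (use that in \<open>auto simp: c_def soddy_diff_half_gap[of j m n i] soddy_add_half_gap[of j m n i] D'_def algebra_simps\<close>)
    have 4: "c j n = (e\<^sup>2 + (k j + k n) * (k m + k i) / 2 - ((k m)\<^sup>2 + (k i)\<^sup>2) / 2) / D'"
      by (use that in \<open>auto simp: c_def soddy_diff_half_gap[of j n m i] soddy_add_half_gap[of j n m i] D'_def algebra_simps\<close>)
    show ?thesis
      unfolding 1 2 3 4 using D
      apply (simp add: field_simps)
      unfolding w_def D_def D'_def by (simp add: field_simps power2_eq_square)
  qed
  have r: "angle_rate e k (\<lambda>j. - (((k j)\<^sup>2 - e\<^sup>2) * z j)) i = w i * z i - (\<Sum>j\<in>UNIV - {i}. c i j * (w j * z j))" for i z
    by (subst angle_rate_apart[OF E]) (simp add: c_def w_def sum_negf)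
  have *: "angle_form e k v u - angle_form e k u v = 
     (w 1 * (1 - c 3 1 - c 4 1) - w 2 * (1 - c 3 2 - c 4 2)) * (v 1 * u 2 - v 2 * u 1) +
     (w 1 * (1 - c 2 1 - c 4 1) - w 3 * (1 - c 2 3 - c 4 3)) * (v 1 * u 3 - v 3 * u 1) +
     (w 1 * (1 - c 2 1 - c 3 1) - w 4 * (1 - c 2 4 - c 3 4)) * (v 1 * u 4 - v 4 * u 1) +
     (w 2 * (1 - c 1 2 - c 4 2) - w 3 * (1 - c 1 3 - c 4 3)) * (v 2 * u 3 - v 3 * u 2) +
     (w 2 * (1 - c 1 2 - c 3 2) - w 4 * (1 - c 1 4 - c 3 4)) * (v 2 * u 4 - v 4 * u 2) +
     (w 3 * (1 - c 1 3 - c 2 3) - w 4 * (1 - c 1 4 - c 2 4)) * (v 3 * u 4 - v 4 * u 3)"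
    unfolding angle_form_def r by (simp add: sum_4 U algebra_simps)
  show ?thesis
    using * by (simp add: key[of 3 4 1 2] key[of 2 4 1 3] key[of 2 3 1 4] key[of 1 4 2 3] key[of 1 3 2 4] key[of 1 2 3 4])
qed

section \<open>Negativity of the Jacobian of the angles\<close>

lemma angle_rate_add_scale:
  "angle_rate e k (\<lambda>j. x j + c * y j) i = angle_rate e k x i + c * angle_rate e k y i"
proof -
  have "(\<Sum>j\<in>UNIV. x j + c * y j) = (\<Sum>j\<in>UNIV. x j) + c * (\<Sum>j\<in>UNIV. y j)"
    "(\<Sum>j\<in>UNIV. half_gap k j * (x j + c * y j)) =
       (\<Sum>j\<in>UNIV. half_gap k j * x j) + c * (\<Sum>j\<in>UNIV. half_gap k j * y j)"
    by (simp_all add: sum.distrib sum_distrib_left algebra_simps)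
  then show ?thesis
    unfolding angle_rate_def times_divide_eq_right add_divide_distrib[symmetric]
    by (simp only:) (simp add: algebra_simps)
qed

lemma angle_form_add_scale_left:
  "angle_form e k (\<lambda>j. v j + c * z j) u = angle_form e k v u + c * angle_form e k z u"
proof -
  have "(\<lambda>j. - (((k j)\<^sup>2 - e\<^sup>2) * (v j + c * z j))) =
     (\<lambda>j. - (((k j)\<^sup>2 - e\<^sup>2) * v j) + c * - (((k j)\<^sup>2 - e\<^sup>2) * z j))"
    by (simp add: fun_eq_iff algebra_simps)
  then show ?thesis
    unfolding angle_form_def
    by (simp only: angle_rate_add_scale distrib_right sum.distrib sum_distrib_left mult.assoc)
qed

lemma angle_form_add_scale_right:
  "angle_form e k u (\<lambda>j. v j + c * z j) = angle_form e k u v + c * angle_form e k u z"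
proof -
  have "(\<Sum>j\<in>UNIV. v j + c * z j) - (v i + c * z i) =
     ((\<Sum>j\<in>UNIV. v j) - v i) + c * ((\<Sum>j\<in>UNIV. z j) - z i)" for i
    by (simp add: sum.distrib sum_distrib_left algebra_simps)
  then show ?thesis
    unfolding angle_form_def
    by (simp only: distrib_left sum.distrib sum_distrib_left mult.left_commute[of _ c])
qed

text \<open>A null vector of a semidefinite symmetric form lies in its kernel. Since
  \<open>u\<close> can be chosen to make the second factors of \<open>angle_form\<close> equal to
  the rates, all rates vanish.\<close>

lemma angle_form_null:
  assumes "\<And>j. k j > 0" and neg: "\<And>z. angle_form e k z z \<le> 0" and null: "angle_form e k v v = 0"
  shows "angle_rate e k (\<lambda>j. - (((k j)\<^sup>2 - e\<^sup>2) * v j)) i = 0"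
proof -
  let ?P = "angle_rate e k (\<lambda>j. - (((k j)\<^sup>2 - e\<^sup>2) * v j))"
  have 0: "angle_form e k v u = 0" for u
  proof (rule ccontr)
    let ?b = "angle_form e k v u" and ?q = "angle_form e k u u"
    assume b: "?b \<noteq> 0"
    have *: "2 * c * ?b + c\<^sup>2 * ?q \<le> 0" for c
      using neg[of "\<lambda>j. v j + c * u j"] null angle_form_commute[of k e u v] assms(1)
      by (simp add: angle_form_add_scale_left angle_form_add_scale_right algebra_simps power2_eq_square)
    have q: "?q \<le> 0" by (rule neg)
    \<comment> \<open>A multiple of \<open>?b\<close> small enough for the linear term to dominate
      the quadratic one; the denominator is at least 1 because \<open>?q\<close> is not
      positive.\<close>
    define c where "c = ?b / (1 - ?q)"
    have "2 * c * ?b + c\<^sup>2 * ?q = ?b\<^sup>2 / (1 - ?q)\<^sup>2 * (2 - ?q)"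
      using q by (simp add: c_def power2_eq_square divide_simps) (simp add: algebra_simps)
    moreover have "\<dots> > 0" using b q by simp
    ultimately show False using *[of c] by simp
  qed
  \<comment> \<open>The chosen direction \<open>u\<close> solves \<open>\<Sum> u - u\<^sub>i = P\<^sub>i\<close>.\<close>
  have "angle_form e k v (\<lambda>i. (\<Sum>j\<in>UNIV. ?P j) / 3 - ?P i) = (\<Sum>i\<in>UNIV. ?P i * ?P i)"
    unfolding angle_form_def sum_subtractf by (rule sum.cong) simp_all
  then have "(\<Sum>i\<in>UNIV. ?P i * ?P i) = 0" by (simp add: 0)
  then show ?thesis
    by (simp add: sum_nonneg_eq_0_iff)
qed

text \<open>Summing the four equations expresses \<open>X\<close> through \<open>B\<close>, and each
  equation then makes \<open>x i\<close> proportional to \<open>k i\<close>. Reinserting this into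
  \<open>B\<close> leaves \<open>c * e\<^sup>2 = 0\<close>. For \<open>e = 0\<close> the remaining
  direction is that of scaling.\<close>

lemma angle_rate_null:
  assumes "\<And>j. k j > 0" "soddy e k > 0" "\<And>i. angle_rate e k x i = 0"
  shows "\<exists>c. (\<forall>i. x i = c * k i) \<and> c * e = 0"
proof -
  define s where "s = soddy e k"
  define X where "X = (\<Sum>j\<in>UNIV. x j)"
  define B where "B = (\<Sum>j\<in>UNIV. half_gap k j * x j)"
  define S where "S = (\<Sum>j\<in>UNIV. k j)"
  have s: "s > 0" using assms(2) by (simp add: s_def)
  have 1: "s * (X - 2 * x i) = half_gap k i * B" for i
    using assms(3)[of i] soddy_half_gap_pos[of k e i, OF assms(1)]
    by (simp add: angle_rate_def s_def X_def B_def)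
  have "(\<Sum>i\<in>UNIV. s * (X - 2 * x i)) = (\<Sum>i\<in>UNIV. half_gap k i * B)"
    by (simp add: 1)
  then have 2: "2 * s * X = S * B"
    by (simp add: sum_distrib_left[symmetric] sum_distrib_right[symmetric] sum_subtractf X_def[symmetric] half_gap_def S_def[symmetric])
  define c where "c = B / (2 * s)"
  have x: "x i = c * k i" for i
  proof -
    have "half_gap k i = S / 2 - k i" by (simp add: half_gap_def S_def)
    then have "2 * (s * (X - 2 * x i)) = 2 * ((S / 2 - k i) * B)"
      using 1[of i] by simp
    then have "4 * s * x i = 2 * k i * B"
      using 2 by (simp add: algebra_simps)
    then show ?thesis using s by (simp add: c_def field_simps)
  qed
  have "B = c * (\<Sum>j\<in>UNIV. half_gap k j * k j)"
    by (simp add: B_def x sum_distrib_left algebra_simps)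
  \<comment> \<open>Euler's identity for the quadratic part of \<open>soddy\<close>, whose gradient
    is \<open>half_gap\<close>.\<close>
  also have "(\<Sum>j\<in>UNIV. half_gap k j * k j) = 2 * (s - e\<^sup>2)"
    unfolding half_gap_def soddy_def s_def
    by (simp add: sum_4 power2_eq_square field_simps)
  finally have "2 * s * c = c * (2 * (s - e\<^sup>2))" using s by (simp add: c_def)
  then have "c * e\<^sup>2 = 0" by (simp add: algebra_simps)
  then have "c * e = 0" by simp
  then show ?thesis using x by blast
qed

text \<open>The forms stay semidefinite because a semidefinite form that is not definite has a null vector.\<close>

lemma psd_path:
  fixes q :: "real \<Rightarrow> 'a::euclidean_space \<Rightarrow> real"
  assumes cont: "continuous_on ({0..1} \<times> UNIV) (\<lambda>(t, v). q t v)"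
    and hom: "\<And>t c v. q t (c *\<^sub>R v) = c\<^sup>2 * q t v"
    and start: "\<And>v. q 0 v \<ge> 0"
    and def: "\<And>t v. \<lbrakk>t \<in> {0..1}; \<And>v. q t v \<ge> 0; v \<noteq> 0\<rbrakk> \<Longrightarrow> q t v \<noteq> 0"
  shows "q 1 v \<ge> 0"
proof -
  have psd: "q t v \<ge> 0" if "\<And>v. v \<in> sphere 0 1 \<Longrightarrow> q t v \<ge> 0" for t v
  proof (cases "v = 0")
    case True
    then show ?thesis using hom[of t 0 v] by simp
  next
    case False
    have "q t v = (norm v)\<^sup>2 * q t (v /\<^sub>R norm v)" using False by (simp flip: hom)
    then show ?thesis using that[of "v /\<^sub>R norm v"] False by simp
  qed
  \<comment> \<open>\<open>A\<close> collects the times at which the form is semidefinite,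
    \<open>B\<close> those at which it is nonpositive somewhere on the unit sphere. Both are closed,
    \<open>B\<close> as the projection of \<open>U\<close> along a compact sphere. They cover the
    interval, and definiteness makes them disjoint.\<close>
  define A where "A = {t \<in> {0..1}. \<forall>v\<in>sphere 0 1. q t v \<ge> 0}"
  define U where "U = {p \<in> sphere 0 1 \<times> {0..1}. q (snd p) (fst p) \<le> 0}"
  define B where "B = {t. \<exists>v. v \<in> sphere 0 1 \<and> (v, t) \<in> U}"
  have "A = (\<Inter>v\<in>UNIV. {t \<in> {0..1}. 0 \<le> q t v})"
    using psd by (force simp: A_def)
  moreover have "closed {t \<in> {0..1}. 0 \<le> q t v}" for v
    by (intro continuous_on_closed_Collect_le continuous_on_const closed_atLeastAtMost
        continuous_on_compose2[OF cont, of _ "\<lambda>t. (t, v)", simplified] continuous_intros) auto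
  ultimately have A: "closed A" by auto
  have "closed U"
    unfolding U_def
  proof (rule continuous_on_closed_Collect_le)
    show "continuous_on (sphere 0 1 \<times> {0..1}) (\<lambda>p. q (snd p) (fst p))"
      by (intro continuous_on_compose2[OF cont, of _ "\<lambda>p. (snd p, fst p)", simplified] continuous_intros) auto
  qed (auto intro!: closed_Times continuous_intros)
  then have "closedin (top_of_set (sphere 0 1 \<times> {0..1})) U"
    by (intro closed_subset) (auto simp: U_def)
  then have "closedin (top_of_set {0..1}) B"
    unfolding B_def by (intro closedin_compact_projection compact_sphere)
  then have B: "closed B" by (rule closedin_closed_trans) simp
  have "t \<notin> B" if t: "t \<in> A" for t
  proof
    assume "t \<in> B"
    then obtain v where v: "norm v = 1" "q t v \<le> 0" by (auto simp: B_def U_def)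
    have "q t v \<ge> 0" for v using t psd by (auto simp: A_def)
    moreover have "v \<noteq> 0" "t \<in> {0..1}" using v t by (auto simp: A_def)
    ultimately have "q t v \<noteq> 0" "q t v \<ge> 0" using def by blast+
    then show False using v by simp
  qed
  then have AB: "A \<inter> B \<inter> {0..1} = {}" by auto
  have cover: "{0..1} \<subseteq> A \<union> B"
  proof
    fix t :: real assume "t \<in> {0..1}"
    then show "t \<in> A \<union> B" by (auto simp: A_def B_def U_def not_le intro: less_imp_le)
  qed
  have "A \<inter> {0..1} = {} \<or> B \<inter> {0..1} = {}"
    using connected_Icc[of 0 "1::real"] A B AB cover unfolding connected_closed by blast
  moreover have "0 \<in> A" using start by (auto simp: A_def)
  moreover have "0 \<in> {0..1::real}" "1 \<in> {0..1::real}" by simp_all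
  ultimately have "1 \<in> A" using cover by blast
  then show ?thesis using psd by (auto simp: A_def)
qed

text \<open>With equal entries the form is a nonnegative multiple of
  \<open>w * Y\<^sup>2 - 2 * (e\<^sup>2 + 2 * c\<^sup>2) * Z\<close>, and
  \<open>Y\<^sup>2 \<le> 4 * Z\<close> bounds this by \<open>- (6 * e\<^sup>2 * Z)\<close>.\<close>

lemma angle_form_const:
  assumes "c > 0" "e\<^sup>2 \<le> c\<^sup>2"
  shows "angle_form e (\<lambda>_. c) v v \<le> 0"
proof -
  define Y where "Y = (\<Sum>i\<in>UNIV. v i)"
  define Z where "Z = (\<Sum>i\<in>UNIV. (v i)\<^sup>2)"
  define w where "w = c\<^sup>2 - e\<^sup>2"
  have w: "w \<ge> 0" using assms by (simp add: w_def)
  have YZ: "Y\<^sup>2 \<le> 4 * Z"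
  proof -
    have "4 * Z - Y\<^sup>2 = (v 1 - v 2)\<^sup>2 + (v 1 - v 3)\<^sup>2 + (v 1 - v 4)\<^sup>2 + (v 2 - v 3)\<^sup>2 + (v 2 - v 4)\<^sup>2 + (v 3 - v 4)\<^sup>2"
      by (simp add: Y_def Z_def sum_4 power2_eq_square algebra_simps)
    also have "\<dots> \<ge> 0" by simp
    finally show ?thesis by simp
  qed
  have s: "soddy e (\<lambda>_. c) = e\<^sup>2 + 2 * c\<^sup>2" "half_gap (\<lambda>_. c) i = c" for i
    by (simp_all add: soddy_def half_gap_def power2_eq_square)
  have r: "angle_rate e (\<lambda>_. c) (\<lambda>j. - ((c\<^sup>2 - e\<^sup>2) * v j)) i =
     w / (e\<^sup>2 + 3 * c\<^sup>2) * (2 * (e\<^sup>2 + 2 * c\<^sup>2) * v i - (e\<^sup>2 + c\<^sup>2) * Y)" for i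
    by (simp add: angle_rate_def s sum_negf sum_distrib_left[symmetric] Y_def[symmetric] w_def[symmetric])
      (simp add: algebra_simps power2_eq_square)
  have "angle_form e (\<lambda>_. c) v v = w / (e\<^sup>2 + 3 * c\<^sup>2) *
      (\<Sum>i\<in>UNIV. (2 * (e\<^sup>2 + 2 * c\<^sup>2) * v i - (e\<^sup>2 + c\<^sup>2) * Y) * (Y - v i))"
    by (simp add: angle_form_def r Y_def[symmetric] sum_distrib_left mult.assoc)
  also have "(\<Sum>i\<in>UNIV. (2 * (e\<^sup>2 + 2 * c\<^sup>2) * v i - (e\<^sup>2 + c\<^sup>2) * Y) * (Y - v i))
     = w * Y\<^sup>2 - 2 * (e\<^sup>2 + 2 * c\<^sup>2) * Z"
    by (simp add: Y_def Z_def w_def sum_4 algebra_simps power2_eq_square)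
  also have "w / (e\<^sup>2 + 3 * c\<^sup>2) * \<dots> \<le> 0"
  proof (rule mult_nonneg_nonpos)
    have "w * Y\<^sup>2 \<le> w * (4 * Z)" using YZ w by (rule mult_left_mono)
    moreover have "w * (4 * Z) - 2 * (e\<^sup>2 + 2 * c\<^sup>2) * Z = - (6 * e\<^sup>2 * Z)"
      by (simp add: w_def algebra_simps)
    moreover have "6 * e\<^sup>2 * Z \<ge> 0" by (simp add: Z_def sum_nonneg)
    ultimately show "w * Y\<^sup>2 - 2 * (e\<^sup>2 + 2 * c\<^sup>2) * Z \<le> 0" by linarith
  qed (use w in simp)
  finally show ?thesis .
qed

text \<open>The expansion has only nonnegative terms, the mixed one being
  \<open>t * (1 - t) * c * S\<close>. Thus, among positive vectors, the region of positive
  \<open>soddy\<close> is star-shaped about each constant vector.\<close>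

lemma soddy_segment:
  assumes "\<And>i. k i > 0" "soddy e k > 0" "c > 0" "0 \<le> t" "t \<le> 1"
  shows "soddy e (\<lambda>i. (1 - t) * c + t * k i) > 0"
proof -
  define S where "S = (\<Sum>i\<in>UNIV. k i)"
  have S: "S > 0" unfolding S_def by (rule sum_pos) (use assms in auto)
  have "soddy e (\<lambda>i. (1 - t) * c + t * k i) =
    (1 - t\<^sup>2) * e\<^sup>2 + t\<^sup>2 * soddy e k + t * (1 - t) * c * S + 2 * c\<^sup>2 * (1 - t)\<^sup>2"
    by (simp add: soddy_def S_def sum_4 power2_eq_square field_simps)
  also have "\<dots> > 0"
  proof (cases "t = 0")
    case True
    then show ?thesis using assms by (simp add: add_nonneg_pos)
  next
    case False
    moreover have "t\<^sup>2 \<le> 1" using assms by (simp add: power_le_one)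
    ultimately show ?thesis using assms S
      by (intro add_pos_nonneg add_nonneg_pos mult_pos_pos mult_nonneg_nonneg) auto
  qed
  finally show ?thesis .
qed

text \<open>Deformation to four equal entries by \<open>psd_path\<close>. A null vector on the way
  would satisfy the equation of \<open>angle_rate_null\<close> with \<open>c * e = 0\<close>, hence
  \<open>c = 0\<close>; as all entries exceed \<open>e\<close>, the vector itself would be
  zero.\<close>

lemma angle_form_nonpos_hyperbolic:
  assumes "e > 0" and k: "\<And>i. k i > e" and s: "soddy e k > 0"
  shows "angle_form e k v v \<le> 0"
proof -
  \<comment> \<open>The constant \<open>2 * e\<close> serves as an equal-entry starting point above
    \<open>e\<close>.\<close>
  define p where "p t = (\<lambda>i. (1 - t) * (2 * e) + t * k i)" for t
  define q where "q t x = - angle_form e (p t) (($) x) (($) x)" for t and x :: "real^4"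
  have p: "p t i > e" if "t \<in> {0..1}" for t i
  proof -
    have "(1 - t) * (2 * e) + t * k i - e = (1 - t) * e + t * (k i - e)"
      by (simp add: algebra_simps)
    also have "\<dots> > 0"
      using that k[of i] assms(1) by (cases "t = 0") (auto intro!: add_nonneg_pos)
    finally show ?thesis by (simp add: p_def)
  qed
  have p0: "p t i > 0" if "t \<in> {0..1}" for t i using p[OF that, of i] assms(1) by simp
  have E: "soddy e (p t) + (half_gap (p t) i)\<^sup>2 \<noteq> 0" if "t \<in> {0..1}" for t i
    using soddy_half_gap_pos[of "p t" e i] p0[OF that] by simp
  have sp: "soddy e (p t) > 0" if "t \<in> {0..1}" for t
    unfolding p_def by (rule soddy_segment) (use that k s assms(1) in \<open>auto intro: less_trans\<close>)
  have "q 1 (\<chi> i. v i) \<ge> 0"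
  proof (rule psd_path[where q = q])
    let ?D = "{0..1} \<times> (UNIV :: (real^4) set)"
    have p_cont: "continuous_on ?D (\<lambda>x. p (fst x) i)" for i
      unfolding p_def by (intro continuous_intros)
    have s_cont: "continuous_on ?D (\<lambda>x. soddy e (p (fst x)))"
      unfolding soddy_def by (intro continuous_intros p_cont) simp_all
    have g_cont: "continuous_on ?D (\<lambda>x. half_gap (p (fst x)) i)" for i
      unfolding half_gap_def by (intro continuous_intros p_cont) simp
    have "continuous_on ?D (\<lambda>x. q (fst x) (snd x))"
      unfolding q_def angle_form_def angle_rate_def
      by (intro continuous_intros p_cont s_cont g_cont ballI) (use E in auto)
    then show "continuous_on ({0..1} \<times> UNIV) (\<lambda>(t, x). q t x)"
      by (simp add: case_prod_unfold)
  next
    fix t c and x :: "real^4"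
    show "q t (c *\<^sub>R x) = c\<^sup>2 * q t x"
      using angle_form_add_scale_left[of e "p t" "\<lambda>_. 0" c "($) x" "\<lambda>j. c * x $ j"]
        angle_form_add_scale_right[of e "p t" "($) x" "\<lambda>_. 0" c "($) x"]
      by (simp add: q_def power2_eq_square) (simp add: angle_form_def angle_rate_def)
  next
    fix x :: "real^4"
    show "q 0 x \<ge> 0"
      using angle_form_const[of "2 * e" e "($) x"] assms(1) by (simp add: q_def p_def power_mult_distrib)
  next
    fix t and x :: "real^4"
    assume t: "t \<in> {0..1}" and psd: "\<And>x. q t x \<ge> 0" and x: "x \<noteq> 0"
    show "q t x \<noteq> 0"
    proof
      assume "q t x = 0"
      moreover have "angle_form e (p t) z z \<le> 0" for z
        using psd[of "\<chi> i. z i"] by (simp add: q_def vec_lambda_inverse)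
      ultimately have "angle_rate e (p t) (\<lambda>j. - (((p t j)\<^sup>2 - e\<^sup>2) * x $ j)) i = 0" for i
        using angle_form_null[of "p t" e "($) x" i] p0[OF t] by (simp add: q_def)
      from angle_rate_null[OF p0[OF t] sp[OF t] this]
      obtain c where c: "\<And>i. - (((p t i)\<^sup>2 - e\<^sup>2) * x $ i) = c * p t i" "c * e = 0"
        by blast
      have "x $ i = 0" for i
      proof -
        have "e\<^sup>2 < (p t i)\<^sup>2" using p[OF t, of i] assms(1) by (intro power_strict_mono) auto
        then show ?thesis using c(1)[of i] c(2) assms(1) by simp
      qed
      then show False using x by (simp add: vec_eq_iff)
    qed
  qed
  then show ?thesis by (simp add: q_def p_def vec_lambda_inverse)
qed

text \<open>For \<open>e = 0\<close> the direction of scaling is a null vector, so the definiteness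
  required by \<open>psd_path\<close> fails. The inequality is instead obtained as the limit of
  those for small positive \<open>d\<close>.\<close>

lemma angle_form_nonpos:
  assumes "e \<ge> 0" and k: "\<And>i. k i > e" and s: "soddy e k > 0"
  shows "angle_form e k v v \<le> 0"
proof (cases "e = 0")
  case False
  with assms(1) have "e > 0" by simp
  then show ?thesis using k s by (rule angle_form_nonpos_hyperbolic)
next
  case True
  have kpos: "k i > 0" for i using k[of i] True by simp
  define s0 where "s0 = soddy 0 k"
  have sd: "soddy d k = s0 + d\<^sup>2" for d by (simp add: soddy_def s0_def)
  have lim: "((\<lambda>d. angle_form d k v v) \<longlongrightarrow> angle_form 0 k v v) (at_right 0)"
    unfolding angle_form_def angle_rate_def sd
  proof (intro tendsto_intros)
    fix i
    show "s0 + 0\<^sup>2 + (half_gap k i)\<^sup>2 \<noteq> 0"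
      using soddy_half_gap_pos[of k 0 i] kpos by (simp add: s0_def)
  qed
  \<comment> \<open>Below the least entry, every \<open>d\<close> satisfies the condition
    \<open>k i > d\<close> of the hyperbolic case.\<close>
  define m where "m = Min (range k)"
  have m: "m > 0" "\<And>i. m \<le> k i" unfolding m_def using kpos by (auto simp: Min_gr_iff)
  have "eventually (\<lambda>d. d \<in> {0<..<m}) (at_right 0)"
    using m(1) by (rule eventually_at_right_real)
  then have "eventually (\<lambda>d. angle_form d k v v \<le> 0) (at_right 0)"
  proof eventually_elim
    case (elim d)
    then show ?case
    proof (intro angle_form_nonpos_hyperbolic)
      show "k i > d" for i using elim m(2)[of i] by simp
      show "soddy d k > 0" using s True by (simp add: sd add_pos_nonneg)
    qed simp
  qed
  then show ?thesis
    using tendsto_upperbound[OF lim] True by simp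
qed

lemma angle_form_eq_0:
  assumes "e \<ge> 0" and k: "\<And>i. k i > e" and s: "soddy e k > 0" and 0: "angle_form e k v v = 0"
  shows "\<exists>c. (\<forall>i. ((k i)\<^sup>2 - e\<^sup>2) * v i = c * k i) \<and> c * e = 0"
proof -
  have kpos: "k i > 0" for i using k[of i] assms(1) by simp
  have "angle_rate e k (\<lambda>j. - (((k j)\<^sup>2 - e\<^sup>2) * v j)) i = 0" for i
    using kpos angle_form_nonpos[OF assms(1) k s] 0 by (rule angle_form_null)
  from angle_rate_null[OF kpos s this]
  obtain c where "\<And>i. - (((k i)\<^sup>2 - e\<^sup>2) * v i) = c * k i" "c * e = 0" by blast
  then show ?thesis by (intro exI[of _ "- c"]) (simp add: minus_equation_iff)
qed

section \<open>Monotonicity along segments\<close>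

lemma half_angle_arctan:
  assumes "soddy e k > 0"
  shows "half_angle e k i = arctan (half_gap k i / sqrt (soddy e k))"
  using assms by (simp add: half_angle_def arg_conv_arctan)

text \<open>The point lies on the imaginary axis, and it is not zero because \<open>soddy\<close>
  plus the squared gap is positive; its argument is therefore a right angle of either sign.\<close>

lemma half_angle_degenerate:
  assumes "\<And>j. k j > 0" "soddy e k \<le> 0"
  shows "half_angle e k i = (if half_gap k i > 0 then pi / 2 else - (pi / 2))"
proof -
  have "half_gap k i \<noteq> 0"
    using soddy_half_gap_pos[of k e i, OF assms(1)] assms(2) by auto
  moreover have "Complex 0 (half_gap k i) = half_gap k i *\<^sub>R \<i>" by (simp add: complex_eq_iff)
  ultimately show ?thesis
    using assms(2) Arg_times_of_real2[of "half_gap k i" \<i>] Arg_times_of_real2[of "- half_gap k i" "- \<i>"]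
    by (auto simp: half_angle_def scaleR_conv_of_real mult.commute not_less)
qed

text \<open>\<open>Arg\<close> is continuous off the nonpositive real axis. The point has
  nonnegative real part and its coordinates never vanish together, so it avoids that axis.\<close>

lemma continuous_on_half_angle:
  assumes "\<And>j. continuous_on A (\<lambda>t. K t j)" "\<And>t j. t \<in> A \<Longrightarrow> K t j > 0"
  shows "continuous_on A (\<lambda>t. half_angle e (K t) i)"
proof -
  have "Complex (sqrt (max 0 (soddy e (K t)))) (half_gap (K t) i) \<notin> \<real>\<^sub>\<le>\<^sub>0" if "t \<in> A" for t
    using soddy_half_gap_pos[of "K t" e i] assms(2)[OF that]
    by (auto simp: complex_nonpos_Reals_iff max_def split: if_splits)
  then show ?thesis
    unfolding half_angle_def Complex_eq soddy_def half_gap_def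
    by (intro continuous_intros assms(1)) (auto simp: soddy_def half_gap_def Complex_eq)
qed

lemma DERIV_half_angle:
  assumes "\<And>j. ((\<lambda>t. K t j) has_real_derivative x j) (at t)" and s: "soddy e (K t) > 0"
  shows "((\<lambda>t. half_angle e (K t) i) has_real_derivative angle_rate e (K t) x i / (2 * sqrt (soddy e (K t)))) (at t)"
proof -
  let ?s = "\<lambda>t. soddy e (K t)" and ?g = "\<lambda>t. half_gap (K t) i"
  let ?B = "\<Sum>j\<in>UNIV. half_gap (K t) j * x j" and ?X = "\<Sum>j\<in>UNIV. x j"
  \<comment> \<open>The partial derivatives of \<open>soddy\<close> are the numbers
    \<open>half_gap\<close>.\<close>
  have ds: "(?s has_real_derivative ?B) (at t)"
    unfolding soddy_def
    by (auto intro!: derivative_eq_intros assms(1))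
      (simp add: half_gap_def sum_4 power2_eq_square field_simps)
  have dg: "(?g has_real_derivative ?X / 2 - x i) (at t)"
    unfolding half_gap_def by (auto intro!: derivative_eq_intros assms(1))
  have sq: "((\<lambda>t. sqrt (?s t)) has_real_derivative ?B / (2 * sqrt (?s t))) (at t)"
    using DERIV_chain2[OF DERIV_real_sqrt[OF s] ds] by (simp add: field_simps)
  let ?D = "inverse (1 + (?g t / sqrt (?s t))\<^sup>2) *
      (((?X / 2 - x i) * sqrt (?s t) - ?g t * (?B / (2 * sqrt (?s t)))) / (sqrt (?s t) * sqrt (?s t)))"
  have "((\<lambda>t. arctan (?g t / sqrt (?s t))) has_real_derivative ?D) (at t)"
    by (rule derivative_eq_intros dg sq refl)+ (use s in auto)
  also have "?D = angle_rate e (K t) x i / (2 * sqrt (?s t))"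
  proof -
    define q where "q = sqrt (?s t)"
    have q: "q > 0" "?s t = q\<^sup>2" using s by (simp_all add: q_def)
    have *: "q\<^sup>2 + (?g t)\<^sup>2 \<noteq> 0" using q(1) by (smt (verit) zero_le_power2 zero_less_power2)
    have "1 + (?g t / q)\<^sup>2 = (q\<^sup>2 + (?g t)\<^sup>2) / q\<^sup>2" using q(1) by (simp add: field_simps)
    then show ?thesis
      unfolding angle_rate_def q_def[symmetric] q(2) using q(1) *
      by (simp add: divide_simps) (simp add: power2_eq_square algebra_simps)
  qed
  finally have "((\<lambda>t. arctan (?g t / sqrt (?s t))) has_real_derivative
      angle_rate e (K t) x i / (2 * sqrt (?s t))) (at t)" .
  \<comment> \<open>The formula by \<open>arctan\<close> needs a positive \<open>soddy\<close>,
    which persists near \<open>t\<close> by continuity.\<close>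
  moreover have "eventually (\<lambda>u. half_angle e (K u) i = arctan (?g u / sqrt (?s u))) (nhds t)"
  proof -
    have "(?s \<longlongrightarrow> ?s t) (nhds t)"
      using DERIV_isCont[OF ds] tendsto_at_iff_tendsto_nhds[of ?s t] by (simp add: isCont_def)
    then have "eventually (\<lambda>u. ?s u > 0) (nhds t)" using s by (rule order_tendstoD)
    then show ?thesis by eventually_elim (rule half_angle_arctan)
  qed
  ultimately show ?thesis by (simp add: DERIV_cong_ev)
qed

text \<open>If \<open>h\<close> rose, it would cross a level \<open>y\<close> outside the finite set
  \<open>h\<close> + \<open>Z\<close>-values. After its last time \<open>c\<close> at that level,
  \<open>h\<close> first avoids those exceptional values and hence does not increase; to reach
  \<open>h b\<close> it must then cross \<open>y\<close> again.\<close>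

lemma nonincreasing_finite_exception:
  fixes h :: "real \<Rightarrow> real"
  assumes "a \<le> b" and cont: "continuous_on {a..b} h" and fin: "finite (h ` Z)"
    and der: "\<And>t. \<lbrakk>t \<in> {a..b}; t \<notin> Z\<rbrakk> \<Longrightarrow> \<exists>D\<le>0. (h has_real_derivative D) (at t)"
  shows "h b \<le> h a"
proof (rule ccontr)
  assume "\<not> h b \<le> h a"
  then have "infinite ({h a<..<h b} - h ` Z)"
    using fin by (simp add: infinite_Ioo)
  then have "{h a<..<h b} - h ` Z \<noteq> {}" by (rule infinite_imp_nonempty)
  then obtain y where "y \<in> {h a<..<h b} - h ` Z" by blast
  then have y: "h a < y" "y < h b" "y \<notin> h ` Z" by auto
  define S where "S = {t \<in> {a..b}. h t = y}"
  have "closed S"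
    unfolding S_def by (intro continuous_closed_preimage_constant cont closed_atLeastAtMost)
  then have "compact ({a..b} \<inter> S)" by (rule compact_Int_closed[OF compact_Icc])
  moreover have "{a..b} \<inter> S \<noteq> {}"
    using IVT'[of h a y b] y cont assms(1) by (auto simp: S_def)
  ultimately obtain c where c: "c \<in> S" "\<And>t. t \<in> S \<Longrightarrow> t \<le> c"
    using compact_attains_sup[of "{a..b} \<inter> S"] by (force simp: S_def)
  then have cab: "c \<in> {a..b}" "h c = y" by (auto simp: S_def)
  with y have "c < b" by (cases "c = b") auto
  have "open (- (h ` Z))" using fin by (simp add: finite_imp_closed open_Compl)
  then obtain U where U: "open U" "U \<inter> {a..b} = h -` (- (h ` Z)) \<inter> {a..b}"
    using cont unfolding continuous_on_open_invariant by metis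
  then have "c \<in> U" using cab y(3) by auto
  then obtain d where d: "d > 0" "ball c d \<subseteq> U" using U(1) open_contains_ball by blast
  define u where "u = min b (c + d / 2)"
  have u: "c < u" "u \<le> b" using d(1) \<open>c < b\<close> by (auto simp: u_def)
  have "h u \<le> h c"
  proof (rule DERIV_nonpos_imp_nonincreasing[of c u h])
    fix t assume t: "c \<le> t" "t \<le> u"
    then have "t \<in> ball c d" using d(1) by (auto simp: u_def dist_real_def)
    moreover have "t \<in> {a..b}" using t u cab by auto
    ultimately have "t \<in> h -` (- h ` Z)" using d(2) U(2) by blast
    then have "t \<notin> Z" by auto
    with \<open>t \<in> {a..b}\<close> show "\<exists>y. DERIV h t :> y \<and> y \<le> 0" using der by blast
  qed (use u in simp)
  moreover have "continuous_on {u..b} h" by (rule continuous_on_subset[OF cont]) (use cab u in auto)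
  ultimately obtain t where "u \<le> t" "t \<le> b" "h t = y"
    using IVT'[of h u y b] cab y u by auto
  then have "t \<in> S" using cab u by (auto simp: S_def)
  then show False using c(2) \<open>u \<le> t\<close> u by force
qed


text \<open>\<open>\<kappa>\<close> stands for \<open>inverse\<close> or \<open>coth\<close>; its
  differential equation turns velocities of the radii into those built into
  \<open>angle_form\<close>. Along the segment, \<open>h\<close> has nonpositive derivative at
  nondegenerate times and finitely many values at the others, so the preceding lemma
  applies.\<close>

lemma vertex_angle_antimono:
  fixes \<kappa> :: "real \<Rightarrow> real" and r r' :: "4 \<Rightarrow> real"
  assumes e: "e \<ge> 0"
    and \<kappa>: "\<And>x. x > 0 \<Longrightarrow> \<kappa> x > e"
    and d\<kappa>: "\<And>x. x > 0 \<Longrightarrow> (\<kappa> has_real_derivative - ((\<kappa> x)\<^sup>2 - e\<^sup>2)) (at x)"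
    and r: "\<And>i. r i > 0" "\<And>i. r' i > 0"
  defines "D \<equiv> (\<Sum>i\<in>UNIV. (vertex_angle e (\<kappa> \<circ> r') i - vertex_angle e (\<kappa> \<circ> r) i) * (r' i - r i))"
  shows "D \<le> 0"
    and "\<lbrakk>soddy e (\<kappa> \<circ> r) > 0; D = 0\<rbrakk> \<Longrightarrow>
           \<exists>c. c * e = 0 \<and> (\<forall>i. ((\<kappa> (r i))\<^sup>2 - e\<^sup>2) * (r' i - r i) = c * \<kappa> (r i))"
proof -
  define v where "v i = r' i - r i" for i
  define x where "x t i = r i + t * v i" for t i
  define K where "K t i = \<kappa> (x t i)" for t i
  define h where "h t = (\<Sum>i\<in>UNIV. vertex_angle e (K t) i * v i)" for t
  define Z where "Z = {t \<in> {0..1}. soddy e (K t) \<le> 0}"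
  have x: "x t i > 0" if "t \<in> {0..1}" for t i
  proof -
    have "x t i = (1 - t) * r i + t * r' i" by (simp add: x_def v_def algebra_simps)
    also have "\<dots> > 0"
      using that r[of i] by (cases "t = 0") (auto intro!: add_nonneg_pos)
    finally show ?thesis .
  qed
  have K: "K t i > e" if "t \<in> {0..1}" for t i using \<kappa> x[OF that] by (simp add: K_def)
  then have K0: "K t i > 0" if "t \<in> {0..1}" for t i using e that by (meson le_less_trans)
  have dK: "((\<lambda>t. K t i) has_real_derivative - (((K t i)\<^sup>2 - e\<^sup>2) * v i)) (at t)" if "t \<in> {0..1}" for t i
  proof -
    have "((\<lambda>t. x t i) has_real_derivative v i) (at t)"
      unfolding x_def by (auto intro!: derivative_eq_intros)
    from DERIV_chain2[OF d\<kappa>[OF x[OF that]] this] show ?thesis by (simp add: K_def algebra_simps)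
  qed
  have dh: "(h has_real_derivative angle_form e (K t) v v / sqrt (soddy e (K t))) (at t)"
    if t: "t \<in> {0..1}" and s: "soddy e (K t) > 0" for t
  proof -
    let ?P = "angle_rate e (K t) (\<lambda>j. - (((K t j)\<^sup>2 - e\<^sup>2) * v j))" and ?q = "sqrt (soddy e (K t))"
    have "(h has_real_derivative
        (\<Sum>i\<in>UNIV. 2 * ((\<Sum>j\<in>UNIV. ?P j / (2 * ?q)) - ?P i / (2 * ?q)) * v i)) (at t)"
      unfolding h_def vertex_angle_def
      by (rule derivative_eq_intros DERIV_half_angle dK t s refl)+ (simp add: algebra_simps)
    also have "(\<Sum>i\<in>UNIV. 2 * ((\<Sum>j\<in>UNIV. ?P j / (2 * ?q)) - ?P i / (2 * ?q)) * v i) =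
        angle_form e (K t) v v / ?q"
    proof -
      have "(\<Sum>i\<in>UNIV. 2 * ((\<Sum>j\<in>UNIV. P j / (2 * q)) - P i / (2 * q)) * v i) =
          (\<Sum>i\<in>UNIV. P i * ((\<Sum>j\<in>UNIV. v j) - v i)) / q" if "q > 0" for P :: "4 \<Rightarrow> real" and q
        using that by (simp add: sum_4 field_simps)
      then show ?thesis using s by (simp add: angle_form_def)
    qed
    finally show ?thesis .
  qed
  have neg: "angle_form e (K t) v v \<le> 0" if "t \<in> {0..1}" "soddy e (K t) > 0" for t
    using e K[OF that(1)] that(2) by (rule angle_form_nonpos)
  have cont: "continuous_on {0..1} h"
    unfolding h_def vertex_angle_def
  proof (intro continuous_intros continuous_on_half_angle)
    have "continuous_on {0..1} (\<lambda>t. K t j)" for j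
      using dK by (intro continuous_at_imp_continuous_on ballI) (auto intro: DERIV_isCont)
    then show "continuous_on {0..1} (\<lambda>t. K t j)" "continuous_on {0..1} (\<lambda>t. K t j)" for j
      by this+
  qed (use K0 in auto)
  \<comment> \<open>At degenerate times each half-angle is one of the two values of
    \<open>\<beta>\<close>, so \<open>h\<close> is determined by a Boolean pattern on four
    indices.\<close>
  have fin: "finite (h ` Z)"
  proof -
    define \<beta> where "\<beta> b = (if b then pi / 2 else - (pi / 2))" for b
    have "h t \<in> range (\<lambda>b :: 4 \<Rightarrow> bool. \<Sum>i\<in>UNIV. (2 * ((\<Sum>j\<in>UNIV. \<beta> (b j)) - \<beta> (b i)) - pi) * v i)"
      if "t \<in> Z" for t
    proof -
      have "half_angle e (K t) i = \<beta> (half_gap (K t) i > 0)" for i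
        using half_angle_degenerate[of "K t" e i] K0[of t] that by (simp add: Z_def \<beta>_def)
      then have "h t = (\<Sum>i\<in>UNIV. (2 * ((\<Sum>j\<in>UNIV. \<beta> (half_gap (K t) j > 0)) - \<beta> (half_gap (K t) i > 0)) - pi) * v i)"
        by (simp add: h_def vertex_angle_def)
      then show ?thesis by (intro image_eqI[where x = "\<lambda>j. half_gap (K t) j > 0"]) simp_all
    qed
    then have "h ` Z \<subseteq> range (\<lambda>b :: 4 \<Rightarrow> bool. \<Sum>i\<in>UNIV. (2 * ((\<Sum>j\<in>UNIV. \<beta> (b j)) - \<beta> (b i)) - pi) * v i)"
      by blast
    then show ?thesis by (rule finite_subset) simp
  qed
  have mono: "h b \<le> h a" if "0 \<le> a" "a \<le> b" "b \<le> 1" for a b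
  proof (rule nonincreasing_finite_exception[OF that(2) _ fin])
    show "continuous_on {a..b} h" by (rule continuous_on_subset[OF cont]) (use that in auto)
    fix t assume "t \<in> {a..b}" "t \<notin> Z"
    then have t: "t \<in> {0..1}" "soddy e (K t) > 0" using that by (auto simp: Z_def)
    show "\<exists>D\<le>0. (h has_real_derivative D) (at t)"
      using dh[OF t] neg[OF t] t(2) by (intro exI conjI) (auto simp: divide_nonpos_pos)
  qed
  have x01: "K 0 = \<kappa> \<circ> r" "K 1 = \<kappa> \<circ> r'"
    by (auto simp: K_def x_def v_def fun_eq_iff)
  have D: "D = h 1 - h 0"
    by (simp add: D_def h_def x01 v_def left_diff_distrib sum_subtractf)
  then show "D \<le> 0" using mono[of 0 1] by simp
  assume s: "soddy e (\<kappa> \<circ> r) > 0" and "D = 0"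
  have const: "h t = h 0" if "t \<in> {0..1}" for t
    using mono[of 0 t] mono[of t 1] that \<open>D = 0\<close> D by auto
  \<comment> \<open>A negative derivative at 0 would make \<open>h\<close> strictly smaller just
    after 0, while \<open>D = 0\<close> forces \<open>h\<close> to be constant.\<close>
  have "angle_form e (K 0) v v = 0"
  proof (rule ccontr)
    assume "angle_form e (K 0) v v \<noteq> 0"
    then have "angle_form e (K 0) v v / sqrt (soddy e (K 0)) < 0"
      using neg[of 0] s by (simp add: x01 divide_neg_pos)
    then obtain d where d: "d > 0" "\<And>u. \<lbrakk>u > 0; u < d\<rbrakk> \<Longrightarrow> h 0 > h u"
      using DERIV_neg_dec_right[OF dh[of 0]] s by (force simp: x01)
    show False using d(2)[of "min (d / 2) 1"] d(1) const[of "min (d / 2) 1"]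
      by (auto simp: min_less_iff_disj)
  qed
  with s have "\<exists>c. (\<forall>i. ((K 0 i)\<^sup>2 - e\<^sup>2) * v i = c * K 0 i) \<and> c * e = 0"
    by (intro angle_form_eq_0[OF e]) (auto simp: K x01(1)[symmetric])
  then show "\<exists>c. c * e = 0 \<and> (\<forall>i. ((\<kappa> (r i))\<^sup>2 - e\<^sup>2) * (r' i - r i) = c * \<kappa> (r i))"
    by (auto simp: K_def x_def v_def)
qed

section \<open>Solid angles of tetrahedra with tangent spheres\<close>

lemma half_gap_add:
  assumes "distinct [i, j, m, n]"
  shows "half_gap k m + half_gap k n = k i + k j"
  using assms unfolding half_gap_def distinct_UNIV_4[OF assms] by simp

text \<open>This is the addition formula for the cosine, with \<open>sqrt soddy\<close> and
  \<open>half_gap\<close> as legs of right triangles. The sum lies in the range of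
  \<open>arccos\<close> because the two gaps add up to the positive number
  \<open>k i + k j\<close>.\<close>

lemma arccos_half_angle:
  assumes k: "\<And>i. k i > 0" and s: "soddy e k > 0" and d: "m \<noteq> n"
  shows "arccos ((soddy e k - half_gap k m * half_gap k n) /
      (sqrt (soddy e k + (half_gap k m)\<^sup>2) * sqrt (soddy e k + (half_gap k n)\<^sup>2))) =
    half_angle e k m + half_angle e k n"
proof (rule arccos_unique)
  let ?s = "soddy e k" and ?g = "half_gap k" and ?\<phi> = "half_angle e k"
  have \<phi>: "?\<phi> l = arctan (?g l / sqrt ?s)" for l using s by (rule half_angle_arctan)
  obtain i j where ij: "distinct [i, j, m, n]"
  proof -
    have "card (UNIV - {m, n}) = 2" using d by (subst card_Diff_subset) auto
    then obtain i j where "UNIV - {m, n} = {i, j}" "i \<noteq> j" by (meson card_2_iff)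
    then have "distinct [i, j, m, n]" using d by auto
    then show thesis by (rule that)
  qed
  have "?g m + ?g n > 0" using half_gap_add[OF ij] k by (simp add: add_pos_pos)
  then have "- ?g n / sqrt ?s \<le> ?g m / sqrt ?s" using s by (intro divide_right_mono) auto
  then have "arctan (- (?g n / sqrt ?s)) \<le> ?\<phi> m" unfolding \<phi> by (simp add: arctan_le_iff)
  then show "0 \<le> ?\<phi> m + ?\<phi> n" by (simp add: \<phi> arctan_minus)
  show "?\<phi> m + ?\<phi> n \<le> pi" 
    using arctan_bounded[of "?g m / sqrt ?s"] arctan_bounded[of "?g n / sqrt ?s"] by (simp add: \<phi>)
  have *: "sqrt (1 + (?g l / sqrt ?s)\<^sup>2) = sqrt (?s + (?g l)\<^sup>2) / sqrt ?s" for l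
    using s by (simp add: power_divide add_divide_eq_iff flip: real_sqrt_divide)
  have q: "sqrt (?s + (?g l)\<^sup>2) > 0" for l using s by (simp add: add_pos_nonneg)
  have cs: "cos (?\<phi> l) = sqrt ?s / sqrt (?s + (?g l)\<^sup>2)" "sin (?\<phi> l) = ?g l / sqrt (?s + (?g l)\<^sup>2)" for l
    unfolding \<phi> cos_arctan sin_arctan * using s by simp_all
  show "cos (?\<phi> m + ?\<phi> n) = (?s - ?g m * ?g n) / (sqrt (?s + (?g m)\<^sup>2) * sqrt (?s + (?g n)\<^sup>2))"
    unfolding cos_add cs using s by (simp add: diff_divide_distrib)
qed

section \<open>Dihedral angles at a corner, for both geometries at once\<close>

lemma gram_form_diff_scaleR:
  assumes "gram_form B"
  shows "B (x - c *\<^sub>R y) (x - c *\<^sub>R y) = B x x - 2 * c * B x y + c\<^sup>2 * B y y"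
proof -
  have s: "B x y = B y x" and d: "B (x - y) z = B x z - B y z"
    and m: "B (c *\<^sub>R x) y = c * B x y" for x y z c
    using assms by (auto simp: gram_form_def)
  have d': "B z (x - y) = B z x - B z y" and m': "B y (c *\<^sub>R x) = c * B y x" for x y z c
    by (metis s d) (metis s m)
  show ?thesis by (simp add: d d' m m' s[of y x] power2_eq_square algebra_simps)
qed

text \<open>The vectors \<open>d j\<close> point from the apex \<open>i\<close> to the other
  vertices. \<open>S\<close> is the radius or its \<open>sinh\<close>, and
  \<open>S i * S j * (k i + k j)\<close> is the edge length or its \<open>sinh\<close>. Positivity
  is asked only where \<open>d m\<close> has coefficient 1, which excludes the zero
  combination.\<close>

locale packed_corner =
  fixes B :: "'b::real_vector \<Rightarrow> 'b \<Rightarrow> real" and e :: real and k S :: "4 \<Rightarrow> real" and i :: 4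
    and d :: "4 \<Rightarrow> 'b"
  assumes B: "gram_form B" and k_pos: "k j > 0" and S_pos: "S j > 0"
    and apex: "(S i)\<^sup>2 * ((k i)\<^sup>2 - e\<^sup>2) = 1"
    and norm: "j \<noteq> i \<Longrightarrow> B (d j) (d j) = (S i * S j * (k i + k j))\<^sup>2"
    and inner: "\<lbrakk>j \<noteq> i; m \<noteq> i; j \<noteq> m\<rbrakk> \<Longrightarrow>
      B (d j) (d m) = (S i)\<^sup>2 * S j * S m * ((k i + k j) * (k i + k m) - 2 * ((k i)\<^sup>2 - e\<^sup>2))"
    and nondegenerate: "distinct [i, j, m, n] \<Longrightarrow> B (d m + x *\<^sub>R d n + y *\<^sub>R d j) (d m + x *\<^sub>R d n + y *\<^sub>R d j) > 0"
begin

text \<open>Projection along the edge separates the factors \<open>S m\<close> and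
  \<open>S n\<close>, which cancel when the vectors are normalised; \<open>apex\<close> removes the
  remaining \<open>(S i)\<^sup>2\<close>.\<close>

lemma orth_inner:
  assumes dist: "distinct [i, j, m, n]"
  shows "B (orth_part B (d j) (d m)) (orth_part B (d j) (d n)) =
     4 * S m * S n / (k i + k j)\<^sup>2 * (soddy e k - half_gap k m * half_gap k n)"
proof -
  let ?w = "(k i)\<^sup>2 - e\<^sup>2"
  define a where "a = k i + k j"
  have a: "a \<noteq> 0" using k_pos[of i] k_pos[of j] by (simp add: a_def)
  have S: "S l \<noteq> 0" for l using S_pos[of l] by simp
  have N: "B (d j) (d j) = (S i * S j * a)\<^sup>2"
    using norm dist by (auto simp: a_def)
  have I: "B (d m) (d j) = (S i)\<^sup>2 * S m * S j * (a * (k i + k m) - 2 * ?w)"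
    "B (d n) (d j) = (S i)\<^sup>2 * S n * S j * (a * (k i + k n) - 2 * ?w)"
    "B (d m) (d n) = (S i)\<^sup>2 * S m * S n * ((k i + k m) * (k i + k n) - 2 * ?w)"
    using inner[of m j] inner[of n j] inner[of m n] dist by (auto simp: a_def mult.commute)
  have "B (orth_part B (d j) (d m)) (orth_part B (d j) (d n)) =
     (S i)\<^sup>2 * S m * S n * (((k i + k m) * (k i + k n) - 2 * ?w)
       - (a * (k i + k m) - 2 * ?w) * (a * (k i + k n) - 2 * ?w) / a\<^sup>2)"
    unfolding orth_part_form[OF B] N I using a S by (simp add: field_simps power2_eq_square)
  also have "b * c - 2 * w - (a * b - 2 * w) * (a * c - 2 * w) / a\<^sup>2 = 2 / a\<^sup>2 * w * (a * (b + c - a) - 2 * w)" for b c w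
    using a by (simp add: field_simps power2_eq_square)
  also have "(S i)\<^sup>2 * S m * S n * (2 / a\<^sup>2 * ?w * (a * (k i + k m + (k i + k n) - a) - 2 * ?w)) =
      ((S i)\<^sup>2 * ?w) * S m * S n * (2 / a\<^sup>2) * (a * (k m + k n + k i - k j) - 2 * ?w)"
  proof -
    have "k i + k m + (k i + k n) - a = k m + k n + k i - k j" by (simp add: a_def)
    then show ?thesis by (simp only: mult_ac)
  qed
  also have "a * (k m + k n + k i - k j) - 2 * ?w = 2 * (soddy e k - half_gap k m * half_gap k n)"
  proof -
    have "distinct [m, n, i, j]" using dist by auto
    from soddy_diff_half_gap[OF this, of e k] show ?thesis
      by (simp add: a_def power2_eq_square field_simps)
  qed
  finally show ?thesis by (simp add: apex a_def)
qed

text \<open>The indices are exchanged: projecting \<open>d m\<close> produces the gap at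
  \<open>n\<close>, since that sum with \<open>soddy\<close> depends only on \<open>k\<close> at
  \<open>i\<close>, \<open>j\<close> and \<open>m\<close>.\<close>

lemma orth_norm:
  assumes dist: "distinct [i, j, m, n]"
  shows "B (orth_part B (d j) (d m)) (orth_part B (d j) (d m)) =
     4 * (S m)\<^sup>2 / (k i + k j)\<^sup>2 * (soddy e k + (half_gap k n)\<^sup>2)"
proof -
  let ?w = "(k i)\<^sup>2 - e\<^sup>2"
  define a where "a = k i + k j"
  have a: "a \<noteq> 0" using k_pos[of i] k_pos[of j] by (simp add: a_def)
  have S: "S l \<noteq> 0" for l using S_pos[of l] by simp
  have N: "B (d j) (d j) = (S i * S j * a)\<^sup>2" "B (d m) (d m) = (S i * S m * (k i + k m))\<^sup>2"
    using norm dist by (auto simp: a_def)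
  have I: "B (d m) (d j) = (S i)\<^sup>2 * S m * S j * (a * (k i + k m) - 2 * ?w)"
    using inner[of m j] dist by (auto simp: a_def mult.commute)
  have "B (orth_part B (d j) (d m)) (orth_part B (d j) (d m)) =
     (S i)\<^sup>2 * (S m)\<^sup>2 * ((k i + k m)\<^sup>2 - (a * (k i + k m) - 2 * ?w)\<^sup>2 / a\<^sup>2)"
    unfolding orth_part_form[OF B] N I using a S by (simp add: field_simps power2_eq_square)
  also have "\<dots> = ((S i)\<^sup>2 * ?w) * (S m)\<^sup>2 * (4 / a\<^sup>2) * (a * (k i + k m) - ?w)"
    using a by (simp add: field_simps power2_eq_square)
  also have "a * (k i + k m) - ?w = soddy e k + (half_gap k n)\<^sup>2"
    using soddy_add_half_gap[of n i j m e k] dist by (auto simp add: a_def power2_eq_square algebra_simps)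
  finally show ?thesis by (simp add: apex a_def)
qed

text \<open>Nondegeneracy gives a strict Cauchy-Schwarz inequality for two vectors projected along
  an edge, and the difference of its sides is a positive multiple of
  \<open>?s * (?g m + ?g n)\<^sup>2\<close>.\<close>

lemma soddy_pos: "soddy e k > 0"
proof -
  obtain j m n where dist: "distinct [i, j, m, n]" using ex_distinct_4 by blast
  then have dist': "distinct [i, j, n, m]" by auto
  let ?v = "orth_part B (d j) (d m)" and ?w = "orth_part B (d j) (d n)"
  let ?s = "soddy e k" and ?g = "half_gap k"
  \<comment> \<open>With this coefficient \<open>?v - c *\<^sub>R ?w\<close> is the part of
    \<open>?v\<close> orthogonal to \<open>?w\<close>.\<close>
  define c where "c = B ?v ?w / B ?w ?w"
  have "?w = d n + 0 *\<^sub>R d m + (- (B (d n) (d j) / B (d j) (d j))) *\<^sub>R d j"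
    by (simp add: orth_part_def)
  then have w: "B ?w ?w > 0" using nondegenerate[OF dist'] by metis
  have "\<exists>x y. ?v - c *\<^sub>R ?w = d m + x *\<^sub>R d n + y *\<^sub>R d j"
    by (intro exI[of _ "- c"] exI[of _ "c * (B (d n) (d j) / B (d j) (d j)) - B (d m) (d j) / B (d j) (d j)"])
      (simp add: orth_part_def algebra_simps)
  then have "0 < B (?v - c *\<^sub>R ?w) (?v - c *\<^sub>R ?w)" using nondegenerate[OF dist] by metis
  also have "\<dots> = B ?v ?v - (B ?v ?w)\<^sup>2 / B ?w ?w"
    using w by (simp add: gram_form_diff_scaleR[OF B] c_def power2_eq_square)
  finally have "(B ?v ?w)\<^sup>2 < B ?v ?v * B ?w ?w" using w by (simp add: field_simps)
  moreover define C where "C = 4 / (k i + k j)\<^sup>2"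
  moreover have "B ?v ?w = C * S m * S n * (?s - ?g m * ?g n)" "B ?v ?v = C * (S m)\<^sup>2 * (?s + (?g n)\<^sup>2)"
     "B ?w ?w = C * (S n)\<^sup>2 * (?s + (?g m)\<^sup>2)"
    unfolding orth_inner[OF dist] orth_norm[OF dist] orth_norm[OF dist'] C_def by simp_all
  ultimately have "(C * S m * S n)\<^sup>2 * (?s - ?g m * ?g n)\<^sup>2 < (C * S m * S n)\<^sup>2 * ((?s + (?g n)\<^sup>2) * (?s + (?g m)\<^sup>2))"
    by (simp add: power2_eq_square algebra_simps)
  then have "(?s - ?g m * ?g n)\<^sup>2 < (?s + (?g n)\<^sup>2) * (?s + (?g m)\<^sup>2)"
    by (rule mult_left_less_imp_less) simp
  then have "0 < ?s * (?g m + ?g n)\<^sup>2" by (simp add: power2_eq_square algebra_simps)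
  then show ?thesis by (simp add: zero_less_mult_iff not_less)
qed

lemma dihedral_angle_half_angle:
  assumes dist: "distinct [i, j, m, n]"
  shows "dihedral_angle B (d j) (d m) (d n) = half_angle e k m + half_angle e k n"
proof -
  have dist': "distinct [i, j, n, m]" using dist by auto
  let ?s = "soddy e k" and ?g = "half_gap k"
  define C where "C = 2 / (k i + k j)"
  have C: "C > 0" using k_pos[of i] k_pos[of j] by (simp add: C_def)
  have "B (orth_part B (d j) (d m)) (orth_part B (d j) (d m)) = (C * S m)\<^sup>2 * (?s + (?g n)\<^sup>2)"
    "B (orth_part B (d j) (d n)) (orth_part B (d j) (d n)) = (C * S n)\<^sup>2 * (?s + (?g m)\<^sup>2)"
    "B (orth_part B (d j) (d m)) (orth_part B (d j) (d n)) = (C * S m) * (C * S n) * (?s - ?g m * ?g n)"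
    unfolding orth_inner[OF dist] orth_norm[OF dist] orth_norm[OF dist'] C_def
    by (simp_all add: power2_eq_square)
  then have "dihedral_angle B (d j) (d m) (d n) =
      arccos ((?s - ?g m * ?g n) / (sqrt (?s + (?g m)\<^sup>2) * sqrt (?s + (?g n)\<^sup>2)))"
    using C S_pos[of m] S_pos[of n]
    by (simp add: dihedral_angle_def form_angle_def real_sqrt_mult mult.commute)
  then show ?thesis
    using arccos_half_angle[of k e m n] k_pos soddy_pos dist by simp
qed

lemma solid_angle_vertex_angle:
  assumes dist: "distinct [i, j, m, n]"
  shows "solid_angle B (d j) (d m) (d n) = vertex_angle e k i"
proof -
  have "distinct [i, m, n, j]" "distinct [i, n, j, m]" using dist by auto
  then have "solid_angle B (d j) (d m) (d n) = 2 * (half_angle e k j + half_angle e k m + half_angle e k n) - pi"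
    using dist by (simp add: solid_angle_def dihedral_angle_half_angle)
  also have "\<dots> = vertex_angle e k i"
    using dist unfolding vertex_angle_def distinct_UNIV_4[OF dist] by simp
  finally show ?thesis .
qed

end

section \<open>Tetrahedra of both geometries as packed corners\<close>

lemma euclidean_tetrahedron_corner:
  fixes x :: "4 \<Rightarrow> 'v"
  assumes tet: "euclidean_tetrahedron t (edge_length r) p" and x: "bij_betw x UNIV t"
    and r: "\<And>i. r (x i) > 0"
  shows "packed_corner (\<bullet>) 0 (inverse \<circ> (r \<circ> x)) (r \<circ> x) i (\<lambda>j. p (x j) - p (x i))"
proof
  have xt: "x j \<in> t" for j using x by (auto simp: bij_betw_def)
  have xe: "x j = x m \<longleftrightarrow> j = m" for j m using x by (auto simp: bij_betw_def inj_def)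
  have D: "dist (p (x j)) (p (x m)) = r (x j) + r (x m)" if "j \<noteq> m" for j m
    using tet xt xe that by (simp add: euclidean_tetrahedron_def edge_length_def)
  have r0: "r (x j) \<noteq> 0" for j using r[of j] by simp
  fix j m n :: 4 and a b :: real
  show "(inverse \<circ> (r \<circ> x)) j > 0" "(r \<circ> x) j > 0" using r by simp_all
  show "((r \<circ> x) i)\<^sup>2 * (((inverse \<circ> (r \<circ> x)) i)\<^sup>2 - 0\<^sup>2) = 1"
    using r0 by (simp add: power_inverse)
  show "(p (x j) - p (x i)) \<bullet> (p (x j) - p (x i)) =
      ((r \<circ> x) i * (r \<circ> x) j * ((inverse \<circ> (r \<circ> x)) i + (inverse \<circ> (r \<circ> x)) j))\<^sup>2" if "j \<noteq> i"
    using r0 that unfolding inner_from_dist by (simp add: D field_simps power2_eq_square)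
  show "(p (x j) - p (x i)) \<bullet> (p (x m) - p (x i)) =
      ((r \<circ> x) i)\<^sup>2 * (r \<circ> x) j * (r \<circ> x) m *
      (((inverse \<circ> (r \<circ> x)) i + (inverse \<circ> (r \<circ> x)) j) * ((inverse \<circ> (r \<circ> x)) i + (inverse \<circ> (r \<circ> x)) m) -
       2 * (((inverse \<circ> (r \<circ> x)) i)\<^sup>2 - 0\<^sup>2))" if "j \<noteq> i" "m \<noteq> i" "j \<noteq> m"
    using r0 that unfolding inner_from_dist by (simp add: D field_simps power2_eq_square)
  assume dist: "distinct [i, j, m, n]"
  let ?z = "(p (x m) - p (x i)) + a *\<^sub>R (p (x n) - p (x i)) + b *\<^sub>R (p (x j) - p (x i))"
  \<comment> \<open>Otherwise the vertex \<open>x m\<close> would lie in the affine hull of the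
    other three.\<close>
  have "?z \<noteq> 0"
  proof
    assume "?z = 0"
    then have z: "p (x m) = (1 + a + b) *\<^sub>R p (x i) + (- b) *\<^sub>R p (x j) + (- a) *\<^sub>R p (x n)"
      by (simp add: algebra_simps add_eq_0_iff2)
    have "p (x m) \<in> affine hull {p (x i), p (x j), p (x n)}"
      unfolding affine_hull_3 mem_Collect_eq using z
      by (intro exI[of _ "1 + a + b"] exI[of _ "- b"] exI[of _ "- a"]) simp
    moreover have "{p (x i), p (x j), p (x n)} \<subseteq> p ` t - {p (x m)}"
      using tet dist xt xe by (auto simp: euclidean_tetrahedron_def inj_on_eq_iff)
    ultimately have "affine_dependent (p ` t)"
      using xt[of m] hull_mono[of "{p (x i), p (x j), p (x n)}"] unfolding affine_dependent_def by blast
    then show False using tet by (simp add: euclidean_tetrahedron_def)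
  qed
  then show "?z \<bullet> ?z > 0" by simp
qed (rule gram_form_inner)

text \<open>Tangency gives \<open>y \<bullet> z = u * s\<close>, and Cauchy-Schwarz with
  \<open>(norm z)\<^sup>2 = s\<^sup>2 - 1\<close> yields
  \<open>u\<^sup>2 < (norm y)\<^sup>2\<close>.\<close>

lemma mink_pos_tangent:
  assumes a: "a \<in> hyperbolic_space" and x: "mink x a = 0" "x \<noteq> 0"
  shows "mink x x > 0"
proof -
  obtain z s where az: "a = (z, s)" by (cases a)
  obtain y u where xy: "x = (y, u)" by (cases x)
  have s: "s\<^sup>2 = 1 + (norm z)\<^sup>2" "s > 0"
    using a unfolding az hyperbolic_space_def mink_def by (auto simp: dot_square_norm power2_eq_square)
  have yz: "y \<bullet> z = u * s" using x(1) by (simp add: xy az mink_def)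
  have y: "norm y > 0"
  proof (rule ccontr)
    assume "\<not> norm y > 0"
    then have "y = 0" by simp
    then show False using yz s(2) x(2) by (simp add: xy zero_prod_def)
  qed
  have "(u * s)\<^sup>2 \<le> (norm y * norm z)\<^sup>2"
    unfolding yz[symmetric] using Cauchy_Schwarz_ineq2[of y z] by (intro abs_le_square_iff[THEN iffD1]) simp
  also have "\<dots> = (norm y)\<^sup>2 * (s\<^sup>2 - 1)" by (simp add: s power_mult_distrib)
  also have "\<dots> < (norm y)\<^sup>2 * s\<^sup>2" using y by (simp add: algebra_simps)
  finally have "u\<^sup>2 * s\<^sup>2 < (norm y)\<^sup>2 * s\<^sup>2" by (simp add: power_mult_distrib)
  then have "u\<^sup>2 < (norm y)\<^sup>2" by (rule mult_right_less_imp_less) simp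
  then show ?thesis by (simp add: xy mink_def dot_square_norm power2_eq_square)
qed

definition coth :: "real \<Rightarrow> real" where "coth x = cosh x / sinh x"

text \<open>A direction vector has length \<open>sinh\<close> of the distance, and the addition
  theorems express \<open>sinh\<close> and \<open>cosh\<close> of \<open>r i + r j\<close> through
  \<open>coth\<close> and \<open>sinh\<close> of the radii. Positivity holds because the
  combinations are nonzero tangent vectors at the apex.\<close>

lemma hyperbolic_tetrahedron_corner:
  fixes x :: "4 \<Rightarrow> 'v"
  assumes tet: "hyperbolic_tetrahedron t (edge_length r) p" and x: "bij_betw x UNIV t"
    and r: "\<And>i. r (x i) > 0"
  shows "packed_corner mink 1 (coth \<circ> (r \<circ> x)) (sinh \<circ> (r \<circ> x)) i
    (\<lambda>j. hyperbolic_direction (p (x i)) (p (x j)))"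
proof
  have xt: "x j \<in> t" for j using x by (auto simp: bij_betw_def)
  have xe: "x j = x m \<longleftrightarrow> j = m" for j m using x by (auto simp: bij_betw_def inj_def)
  have H: "p (x j) \<in> hyperbolic_space" for j using tet xt by (auto simp: hyperbolic_tetrahedron_def)
  then have H1: "mink (p (x j)) (p (x j)) = -1" for j by (simp add: hyperbolic_space_def)
  have D: "mink (p (x j)) (p (x m)) = - cosh (r (x j) + r (x m))" if "j \<noteq> m" for j m
    using tet xt xe that H by (simp add: mink_from_dist hyperbolic_tetrahedron_def edge_length_def)
  define s c where "s j = sinh (r (x j))" and "c j = cosh (r (x j))" for j
  have s: "s j > 0" and cp: "c j > 0" for j using r by (simp_all add: s_def c_def)
  have c: "(c j)\<^sup>2 = (s j)\<^sup>2 + 1" for j by (simp add: s_def c_def cosh_square_eq)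
  have cc: "c j * c j = s j * s j + 1" for j using c[of j] by (simp add: power2_eq_square)
  have ch: "cosh (r (x j) + r (x m)) = c j * c m + s j * s m" for j m
    by (simp add: cosh_add s_def c_def)
  have k: "(coth \<circ> (r \<circ> x)) j = c j / s j" "(sinh \<circ> (r \<circ> x)) j = s j" for j
    by (simp_all add: coth_def s_def c_def)
  have s0: "s j \<noteq> 0" for j using s[of j] by simp
  fix j m n :: 4 and a b :: real
  show "(coth \<circ> (r \<circ> x)) j > 0" "(sinh \<circ> (r \<circ> x)) j > 0" unfolding k using s cp by simp_all
  show "((sinh \<circ> (r \<circ> x)) i)\<^sup>2 * (((coth \<circ> (r \<circ> x)) i)\<^sup>2 - 1\<^sup>2) = 1"
    unfolding k using s0 c[of i] by (simp add: field_simps)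
  let ?d = "\<lambda>j. hyperbolic_direction (p (x i)) (p (x j))"
  show "mink (?d j) (?d j) =
      ((sinh \<circ> (r \<circ> x)) i * (sinh \<circ> (r \<circ> x)) j * ((coth \<circ> (r \<circ> x)) i + (coth \<circ> (r \<circ> x)) j))\<^sup>2" if "j \<noteq> i"
  proof -
    have "mink (?d j) (?d j) = (c i * c j + s i * s j)\<^sup>2 - 1"
      unfolding mink_direction[OF H] using that by (simp add: D H1 ch power2_eq_square algebra_simps)
    also have "\<dots> = (c i)\<^sup>2 * (c j)\<^sup>2 + 2 * (c i * c j * s i * s j) + (s i)\<^sup>2 * (s j)\<^sup>2 - 1"
      by (simp add: power2_eq_square algebra_simps)
    also have "\<dots> = (c i)\<^sup>2 * (s j)\<^sup>2 + 2 * (c i * c j * s i * s j) + (s i)\<^sup>2 * (c j)\<^sup>2"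
      unfolding c by (simp add: algebra_simps)
    also have "\<dots> = (s i * s j * (c i / s i + c j / s j))\<^sup>2"
      using s0[of i] s0[of j] by (simp add: field_simps power2_eq_square)
    finally show ?thesis unfolding k .
  qed
  show "mink (?d j) (?d m) =
      ((sinh \<circ> (r \<circ> x)) i)\<^sup>2 * (sinh \<circ> (r \<circ> x)) j * (sinh \<circ> (r \<circ> x)) m *
      (((coth \<circ> (r \<circ> x)) i + (coth \<circ> (r \<circ> x)) j) * ((coth \<circ> (r \<circ> x)) i + (coth \<circ> (r \<circ> x)) m) -
       2 * (((coth \<circ> (r \<circ> x)) i)\<^sup>2 - 1\<^sup>2))" if "j \<noteq> i" "m \<noteq> i" "j \<noteq> m"
  proof -
    have w: "(c i / s i)\<^sup>2 - 1\<^sup>2 = 1 / (s i)\<^sup>2" using s0[of i] c[of i] by (simp add: field_simps)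
    have "mink (?d j) (?d m) = (c i * c j + s i * s j) * (c i * c m + s i * s m) - (c j * c m + s j * s m)"
      unfolding mink_direction[OF H] using that by (simp add: D ch algebra_simps)
    also have "\<dots> = ((c i)\<^sup>2 - 1) * (c j * c m) + c i * s i * (c j * s m + s j * c m) + ((s i)\<^sup>2 - 1) * (s j * s m)"
      by (simp add: power2_eq_square algebra_simps)
    also have "\<dots> = (s i)\<^sup>2 * (c j * c m) + c i * s i * (c j * s m + s j * c m) + ((c i)\<^sup>2 - 2) * (s j * s m)"
      by (simp add: c algebra_simps)
    also have "\<dots> = (s i)\<^sup>2 * s j * s m * ((c i / s i + c j / s j) * (c i / s i + c m / s m) - 2 * (1 / (s i)\<^sup>2))"
      using s0[of i] s0[of j] s0[of m] by (simp add: field_simps power2_eq_square)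
    finally show ?thesis unfolding k w .
  qed
  assume dist: "distinct [i, j, m, n]"
  let ?z = "?d m + a *\<^sub>R ?d n + b *\<^sub>R ?d j"
  have lin: "mink (y + c *\<^sub>R y') z = mink y z + c * mink y' z" for y y' z c
    by (simp add: mink_def inner_add_left algebra_simps)
  have "mink (?d l) (p (x i)) = 0" for l
    using H1[of i] by (simp add: hyperbolic_direction_def lin) (simp add: mink_def inner_commute)
  then have tangent: "mink ?z (p (x i)) = 0" by (simp add: lin)
  have "?z \<noteq> 0"
  proof
    assume "?z = 0"
    \<comment> \<open>\<open>- q\<close> is the coefficient of the apex once \<open>?z = 0\<close>
      is solved for \<open>p (x m)\<close>.\<close>
    define q where "q = mink (p (x i)) (p (x m)) + a * mink (p (x i)) (p (x n)) + b * mink (p (x i)) (p (x j))"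
    have "p (x m) = (- q) *\<^sub>R p (x i) + (- a) *\<^sub>R p (x n) + (- b) *\<^sub>R p (x j)"
      using \<open>?z = 0\<close> by (simp add: hyperbolic_direction_def q_def algebra_simps add_eq_0_iff2) 
    also have "\<dots> \<in> span {p (x i), p (x j), p (x n)}"
      by (intro span_add span_scale span_base) auto
    finally have "p (x m) \<in> span {p (x i), p (x j), p (x n)}" .
    moreover have "{p (x i), p (x j), p (x n)} \<subseteq> p ` t - {p (x m)}"
      using tet dist xt xe by (auto simp: hyperbolic_tetrahedron_def inj_on_eq_iff)
    ultimately have "dependent (p ` t)"
      using xt[of m] span_mono[of "{p (x i), p (x j), p (x n)}"] unfolding dependent_def by blast
    then show False using tet by (simp add: hyperbolic_tetrahedron_def)
  qed
  then show "mink ?z ?z > 0" using mink_pos_tangent[OF H tangent] by simp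
qed (rule gram_form_mink)

lemma range_4:
  assumes "bij_betw x (UNIV :: 4 set) t" "distinct [i, j, m, n]"
  shows "t = {x i, x j, x m, x n}" "distinct [x i, x j, x m, x n]"
  using assms distinct_UNIV_4[OF assms(2)] by (auto simp: bij_betw_def inj_def)

lemma euclidean_solid_angle_vertex_angle:
  assumes tet: "euclidean_tetrahedron t (edge_length r) p" and x: "bij_betw x (UNIV :: 4 set) t"
    and r: "\<And>i. r (x i) > 0"
  shows "euclidean_solid_angle t (edge_length r) (x i) = vertex_angle 0 (inverse \<circ> (r \<circ> x)) i"
proof -
  obtain j m n where d: "distinct [i, j, m, n]" using ex_distinct_4 by blast
  show ?thesis
    unfolding euclidean_solid_angle_eq[OF tet range_4[OF x d]]
    by (rule packed_corner.solid_angle_vertex_angle[OF euclidean_tetrahedron_corner[OF assms] d])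
qed

lemma hyperbolic_solid_angle_vertex_angle:
  assumes tet: "hyperbolic_tetrahedron t (edge_length r) p" and x: "bij_betw x (UNIV :: 4 set) t"
    and r: "\<And>i. r (x i) > 0"
  shows "hyperbolic_solid_angle t (edge_length r) (x i) = vertex_angle 1 (coth \<circ> (r \<circ> x)) i"
proof -
  obtain j m n where d: "distinct [i, j, m, n]" using ex_distinct_4 by blast
  show ?thesis
    unfolding hyperbolic_solid_angle_eq[OF tet range_4[OF x d]]
    by (rule packed_corner.solid_angle_vertex_angle[OF hyperbolic_tetrahedron_corner[OF assms] d])
qed

section \<open>Monotonicity on a single tetrahedron\<close>

lemma DERIV_coth:
  assumes "x > 0"
  shows "(coth has_real_derivative - ((coth x)\<^sup>2 - 1\<^sup>2)) (at x)"
proof -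
  have "sinh x \<noteq> 0" using assms by simp
  then show ?thesis
    unfolding coth_def [abs_def]
    by (auto intro!: derivative_eq_intros simp: power2_eq_square field_simps)
qed

lemma coth_gt_1:
  assumes "x > 0"
  shows "coth x > 1"
  using assms by (simp add: coth_def sinh_def cosh_def less_divide_eq)

lemma ex_bij_betw_4:
  assumes "card t = 4"
  obtains x where "bij_betw x (UNIV :: 4 set) t"
  using finite_same_card_bij[of "UNIV :: 4 set" t] assms card.infinite by fastforce

lemma euclidean_tetrahedron_antimono:
  assumes t: "card t = 4"
    and tet: "euclidean_tetrahedron t (edge_length r) p" "euclidean_tetrahedron t (edge_length r') p'"
    and pos: "\<And>v. v \<in> t \<Longrightarrow> r v > 0" "\<And>v. v \<in> t \<Longrightarrow> r' v > 0"
  defines "D \<equiv> (\<Sum>v\<in>t. (euclidean_solid_angle t (edge_length r') v - euclidean_solid_angle t (edge_length r) v)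
      * (r' v - r v))"
  shows "D \<le> 0" and "D = 0 \<Longrightarrow> \<exists>c. \<forall>v\<in>t. r' v = c * r v"
proof -
  obtain x where x: "bij_betw x (UNIV :: 4 set) t" using t by (rule ex_bij_betw_4)
  then have xt: "x ` UNIV = t" by (simp add: bij_betw_def)
  then have pos': "r (x i) > 0" "r' (x i) > 0" for i using pos by auto
  have D: "D = (\<Sum>i\<in>UNIV. (vertex_angle 0 (inverse \<circ> (r' \<circ> x)) i - vertex_angle 0 (inverse \<circ> (r \<circ> x)) i)
      * ((r' \<circ> x) i - (r \<circ> x) i))"
    unfolding D_def sum.reindex_bij_betw[OF x, symmetric]
    using euclidean_solid_angle_vertex_angle[OF tet(1) x] euclidean_solid_angle_vertex_angle[OF tet(2) x] pos'
    by simp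
  have \<kappa>: "inverse y > 0" "(inverse has_real_derivative - ((inverse y)\<^sup>2 - 0\<^sup>2)) (at y)" if "y > 0" for y :: real
    using that by (auto intro!: derivative_eq_intros simp: power2_eq_square)
  have mono: "D \<le> 0" "D = 0 \<Longrightarrow> \<exists>c. c * 0 = 0 \<and>
      (\<forall>i. ((inverse ((r \<circ> x) i))\<^sup>2 - 0\<^sup>2) * ((r' \<circ> x) i - (r \<circ> x) i) = c * inverse ((r \<circ> x) i))"
    using vertex_angle_antimono[of 0 inverse "r \<circ> x" "r' \<circ> x"] \<kappa> pos'
      packed_corner.soddy_pos[OF euclidean_tetrahedron_corner[OF tet(1) x pos'(1)]] unfolding D by simp_all
  then show "D \<le> 0" by simp
  assume "D = 0"
  then obtain c where c: "(inverse (r (x i)))\<^sup>2 * (r' (x i) - r (x i)) = c * inverse (r (x i))" for i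
    using mono(2) by auto
  \<comment> \<open>Clearing the inverses in the equality condition shows that \<open>r'\<close> is
    a multiple of \<open>r\<close> on the tetrahedron.\<close>
  have "r' (x i) = (1 + c) * r (x i)" for i
  proof -
    have "inverse (r (x i)) * (inverse (r (x i)) * (r' (x i) - r (x i)) - c) = 0"
      using c[of i] by (simp add: power2_eq_square algebra_simps)
    then have "inverse (r (x i)) * (r' (x i) - r (x i)) = c" using pos'(1)[of i] by simp
    then show ?thesis using pos'(1)[of i] by (simp add: field_simps)
  qed
  then show "\<exists>c. \<forall>v\<in>t. r' v = c * r v" unfolding xt[symmetric] by blast
qed

text \<open>For \<open>e = 1\<close> the constant of the equality case vanishes, and
  \<open>coth\<close> exceeds 1, so no direction of scaling survives.\<close>

lemma hyperbolic_tetrahedron_antimono: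
  assumes t: "card t = 4"
    and tet: "hyperbolic_tetrahedron t (edge_length r) p" "hyperbolic_tetrahedron t (edge_length r') p'"
    and pos: "\<And>v. v \<in> t \<Longrightarrow> r v > 0" "\<And>v. v \<in> t \<Longrightarrow> r' v > 0"
  defines "D \<equiv> (\<Sum>v\<in>t. (hyperbolic_solid_angle t (edge_length r') v - hyperbolic_solid_angle t (edge_length r) v)
      * (r' v - r v))"
  shows "D \<le> 0" and "D = 0 \<Longrightarrow> \<forall>v\<in>t. r' v = r v"
proof -
  obtain x where x: "bij_betw x (UNIV :: 4 set) t" using t by (rule ex_bij_betw_4)
  then have xt: "x ` UNIV = t" by (simp add: bij_betw_def)
  then have pos': "r (x i) > 0" "r' (x i) > 0" for i using pos by auto
  have D: "D = (\<Sum>i\<in>UNIV. (vertex_angle 1 (coth \<circ> (r' \<circ> x)) i - vertex_angle 1 (coth \<circ> (r \<circ> x)) i)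
      * ((r' \<circ> x) i - (r \<circ> x) i))"
    unfolding D_def sum.reindex_bij_betw[OF x, symmetric]
    using hyperbolic_solid_angle_vertex_angle[OF tet(1) x] hyperbolic_solid_angle_vertex_angle[OF tet(2) x] pos'
    by simp
  have mono: "D \<le> 0" "D = 0 \<Longrightarrow> \<exists>c. c * 1 = 0 \<and>
      (\<forall>i. ((coth ((r \<circ> x) i))\<^sup>2 - 1\<^sup>2) * ((r' \<circ> x) i - (r \<circ> x) i) = c * coth ((r \<circ> x) i))"
    using vertex_angle_antimono[of 1 coth "r \<circ> x" "r' \<circ> x", OF _ coth_gt_1 DERIV_coth] pos'
      packed_corner.soddy_pos[OF hyperbolic_tetrahedron_corner[OF tet(1) x pos'(1)]] unfolding D by simp_all
  then show "D \<le> 0" by simp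
  assume "D = 0"
  then have c: "((coth (r (x i)))\<^sup>2 - 1) * (r' (x i) - r (x i)) = 0" for i
    using mono(2) by auto
  have "r' (x i) = r (x i)" for i
  proof -
    have "1 < (coth (r (x i)))\<^sup>2" using coth_gt_1[OF pos'(1)[of i]] by simp
    then show ?thesis using c[of i] by simp
  qed
  then show "\<forall>v\<in>t. r' v = r v" unfolding xt[symmetric] by blast
qed

section \<open>Tetrahedra of a triangulated manifold\<close>

lemma tetrahedron_vertex:
  assumes "simplicial_complex C" "t \<in> tetrahedra C" "v \<in> t"
  shows "v \<in> vertices C"
proof -
  have t: "\<not> affine_dependent t" "convex hull t \<in> C" using assms(2) by (auto simp: tetrahedra_def)
  have "{v} face_of convex hull t"
    unfolding face_of_convex_hull_affine_independent[OF t(1)] using assms(3) by (intro exI[of _ "{v}"]) auto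
  then show ?thesis
    using assms(1) t(2) unfolding simplicial_complex_def vertices_def by blast
qed

lemma finite_vertices:
  assumes "simplicial_complex C"
  shows "finite (vertices C)"
proof -
  have "finite ((\<lambda>v. {v}) -` C)"
    using assms by (intro finite_vimageI) (auto simp: simplicial_complex_def)
  then show ?thesis by (simp add: vertices_def vimage_def)
qed

lemma finite_tetrahedra:
  assumes "simplicial_complex C"
  shows "finite (tetrahedra C)"
proof (rule finite_subset)
  show "tetrahedra C \<subseteq> Pow (vertices C)" using tetrahedron_vertex[OF assms] by auto
qed (simp add: finite_vertices[OF assms])

text \<open>The intersection is a common face, hence the convex hull of a subset of either vertex
  set; its extreme points identify the two subsets.\<close>

lemma tetrahedra_meet:
  assumes C: "simplicial_complex C" and t: "t \<in> tetrahedra C" "t' \<in> tetrahedra C"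
    and meet: "convex hull t \<inter> convex hull t' \<noteq> {}"
  shows "t \<inter> t' \<noteq> {}"
proof -
  have ind: "\<not> affine_dependent t" "\<not> affine_dependent t'"
    and mem: "convex hull t \<in> C" "convex hull t' \<in> C" using t by (auto simp: tetrahedra_def)
  let ?F = "convex hull t \<inter> convex hull t'"
  have "?F face_of convex hull t" "?F face_of convex hull t'"
    using C mem unfolding simplicial_complex_def by (blast, metis Int_commute)
  then obtain c c' where c: "c \<subseteq> t" "?F = convex hull c" "c' \<subseteq> t'" "?F = convex hull c'"
    unfolding face_of_convex_hull_affine_independent[OF ind(1)]
      face_of_convex_hull_affine_independent[OF ind(2)] by auto
  have "\<not> affine_dependent c" "\<not> affine_dependent c'"
    using ind c affine_dependent_subset by blast+
  then have "{x. x extreme_point_of convex hull c} = c" "{x. x extreme_point_of convex hull c'} = c'"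
    by (simp_all add: extreme_point_of_convex_hull_affine_independent)
  moreover have "convex hull c = convex hull c'" using c(2,4) by simp
  ultimately have "c = c'" by metis
  moreover have "c \<noteq> {}" using meet c(2) by auto
  ultimately show ?thesis using c by auto
qed

text \<open>A face of \<open>T\<close> that meets its relative interior is all of \<open>T\<close>,
  so by maximality no other simplex meets it. It is thus the complement of a finite union of closed
  sets.\<close>

lemma openin_rel_interior_maximal:
  assumes C: "simplicial_complex C" and T: "T \<in> C" and max: "\<And>S. \<lbrakk>S \<in> C; T \<subseteq> S\<rbrakk> \<Longrightarrow> S = T"
  shows "openin (top_of_set (\<Union>C)) (rel_interior T)"
proof -
  have fin: "finite C" and face: "\<And>S S'. \<lbrakk>S \<in> C; S' \<in> C\<rbrakk> \<Longrightarrow> S \<inter> S' face_of S"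
    and simp: "\<And>S. S \<in> C \<Longrightarrow> \<exists>n. n simplex S"
    using C by (auto simp: simplicial_complex_def)
  have cl: "closed S" if "S \<in> C" for S
    using simp[OF that] by (metis compact_imp_closed compact_simplex)
  have cv: "convex T" using simp[OF T] by (auto simp: simplex_def)
  have disj: "rel_interior T \<inter> S = {}" if "S \<in> C" "S \<noteq> T" for S
  proof (rule ccontr)
    assume "rel_interior T \<inter> S \<noteq> {}"
    then have "(T \<inter> S) \<inter> rel_interior T \<noteq> {}" using rel_interior_subset by blast
    then have "T \<subseteq> T \<inter> S" 
      using subset_of_face_of[OF face[OF T that(1)], of T] by blast
    then show False using max[of S] that by auto
  qed
  have "rel_interior T = \<Union>C - (\<Union>(C - {T}) \<union> rel_frontier T)"
    using disj rel_interior_subset[of T] T cl[OF T] by (auto simp: rel_frontier_def)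
  then have "rel_interior T = \<Union>C \<inter> - (\<Union>(C - {T}) \<union> rel_frontier T)" by blast
  moreover have "closed (\<Union>(C - {T}) \<union> rel_frontier T)"
    using fin cl T cv by (intro closed_Un closed_Union) (auto simp: closed_rel_frontier)
  ultimately show ?thesis unfolding openin_open by blast
qed

text \<open>Near a relative interior point, the complex looks like the affine hull of
  \<open>T\<close> and, through a chart, like an open subset of 3-space. Invariance of dimension,
  applied to \<open>h\<close> and to its inverse \<open>k\<close>, gives
  \<open>aff_dim T = 3\<close>.\<close>

lemma maximal_simplex_tetrahedron:
  assumes C: "triangulates C M" and M: "closed_connected_3_manifold M"
    and T: "T \<in> C" "T \<noteq> {}" and max: "\<And>S. \<lbrakk>S \<in> C; T \<subseteq> S\<rbrakk> \<Longrightarrow> S = T"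
  obtains t where "t \<in> tetrahedra C" "T = convex hull t"
proof -
  have sc: "simplicial_complex C" and "top_of_set (\<Union>C) homeomorphic_space M"
    using C by (auto simp: triangulates_def)
  then obtain f where f: "homeomorphic_map (top_of_set (\<Union>C)) M f"
    using homeomorphic_space by blast
  obtain n where n: "n simplex T" using sc T(1) unfolding simplicial_complex_def by blast
  then obtain t where t: "\<not> affine_dependent t" "int (card t) = n + 1" "T = convex hull t"
    by (auto simp: simplex_def)
  have "rel_interior T \<noteq> {}" using T(2) t(3) rel_interior_eq_empty convex_convex_hull by metis
  then obtain x where x: "x \<in> rel_interior T" by blast
  then have xC: "x \<in> \<Union>C" using T(1) rel_interior_subset by blast
  then have "f x \<in> topspace M" using f homeomorphic_imp_surjective_map by fastforce
  then obtain U and W :: "(real^3) set" where U: "openin M U" "f x \<in> U" and W: "open W"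
    and "subtopology M U homeomorphic_space top_of_set W"
    using M unfolding closed_connected_3_manifold_def by blast
  then obtain g where g: "homeomorphic_map (subtopology M U) (top_of_set W) g"
    using homeomorphic_space by blast
  \<comment> \<open>Small enough to be open in the affine hull of \<open>T\<close> and to be mapped
    by \<open>f\<close> into the chart domain.\<close>
  define N where "N = rel_interior T \<inter> {y \<in> \<Union>C. f y \<in> U}"
  have opU: "openin (top_of_set (\<Union>C)) {y \<in> \<Union>C. f y \<in> U}"
    using openin_continuous_map_preimage[OF homeomorphic_imp_continuous_map[OF f] U(1)] by simp
  have opT: "openin (top_of_set (\<Union>C)) (rel_interior T)"
    by (rule openin_rel_interior_maximal[OF sc T(1) max])
  have opN: "openin (top_of_set (\<Union>C)) N"
    unfolding N_def using opT opU by (rule openin_Int)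
  have NC: "N \<subseteq> \<Union>C" "N \<noteq> {}" using x xC U(2) by (auto simp: N_def)
  have f_N: "homeomorphic_map (top_of_set N) (subtopology M (f ` N)) f"
    using homeomorphic_map_subtopologies[OF f, of N "f ` N"] NC(1)
      homeomorphic_imp_surjective_map[OF f]
    by (auto simp: subtopology_subtopology Int_absorb1 image_subset_iff)
  have fN: "openin M (f ` N)" "f ` N \<subseteq> U"
    using homeomorphic_map_openness[OF f, of N] opN NC by (simp, auto simp: N_def)
  define h where "h = g \<circ> f"
  have sub: "subtopology (subtopology M U) (f ` N) = subtopology M (f ` N)"
    using fN(2) by (simp add: subtopology_subtopology Int_absorb1)
  have gfN: "g ` f ` N \<subseteq> W"
    using homeomorphic_imp_surjective_map[OF g] fN openin_subset[OF fN(1)] by auto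
  have g_N: "homeomorphic_map (subtopology M (f ` N)) (top_of_set (h ` N)) g"
    using homeomorphic_map_subtopologies[OF g, of "f ` N" "h ` N"] fN openin_subset[OF fN(1)] gfN
      homeomorphic_imp_surjective_map[OF g] sub
    by (auto simp: h_def subtopology_subtopology Int_absorb1 image_comp image_subset_iff)
  have hN: "homeomorphic_map (top_of_set N) (top_of_set (h ` N)) h"
    using homeomorphic_map_compose[OF f_N g_N] by (simp add: h_def)
  have "openin (subtopology M U) (f ` N)"
    using fN by (metis inf.absorb_iff2 inf_commute openin_subtopology_Int)
  then have "openin (top_of_set W) (g ` f ` N)"
    using g homeomorphic_map_openness_eq by blast
  then have oph: "open (h ` N)" using W by (simp add: h_def image_comp openin_open_eq)
  obtain k where k: "homeomorphic_maps (top_of_set N) (top_of_set (h ` N)) h k"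
    using hN homeomorphic_map_maps by blast
  have "aff_dim (affine hull T) \<le> aff_dim (UNIV :: (real^3) set)"
  proof (rule invariance_of_dimension_affine_sets)
    show "openin (top_of_set (affine hull T)) N"
    proof -
      have "openin (top_of_set (rel_interior T)) N"
        using openin_subset_trans[OF opN] rel_interior_subset[of T] T(1) by (auto simp: N_def)
      then show ?thesis using openin_rel_interior openin_trans by blast
    qed
    show "continuous_on N h" "h \<in> N \<rightarrow> UNIV" "inj_on h N" "N \<noteq> {}"
      using k NC hN homeomorphic_imp_injective_map[OF hN] by (auto simp: homeomorphic_maps_def)
  qed auto
  moreover have "aff_dim (UNIV :: (real^3) set) \<le> aff_dim (affine hull T)"
  proof (rule invariance_of_dimension_affine_sets)
    show "openin (top_of_set UNIV) (h ` N)" using oph by simp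
    show "continuous_on (h ` N) k" "inj_on k (h ` N)" "h ` N \<noteq> {}"
      using k NC by (auto simp: homeomorphic_maps_def intro: inj_on_inverseI)
    have "k \<in> h ` N \<rightarrow> N" using k by (auto simp: homeomorphic_maps_def)
    then show "k \<in> h ` N \<rightarrow> affine hull T"
      using rel_interior_subset[of T] hull_subset[of T affine] by (fastforce simp: N_def)
  qed auto
  ultimately have "aff_dim T = 3" by (simp add: aff_dim_affine_hull)
  then have "card t = 4"
    using aff_dim_affine_independent[OF t(1)] by (simp add: t(3) aff_dim_convex_hull)
  then show thesis using that t T(1) by (auto simp: tetrahedra_def)
qed

lemma subset_tetrahedron:
  assumes C: "triangulates C M" and M: "closed_connected_3_manifold M" and S: "S \<in> C" "S \<noteq> {}"
  obtains t where "t \<in> tetrahedra C" "S \<subseteq> convex hull t"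
proof -
  have "finite C" using C by (auto simp: triangulates_def simplicial_complex_def)
  then obtain T where T: "T \<in> C" "S \<subseteq> T" "\<And>S'. \<lbrakk>S' \<in> C; T \<subseteq> S'\<rbrakk> \<Longrightarrow> T = S'"
    using finite_has_maximal2[OF _ S(1)] by metis
  show thesis
  proof (rule maximal_simplex_tetrahedron[OF C M T(1)])
    show "T \<noteq> {}" using S T(2) by auto
    show "S' = T" if "S' \<in> C" "T \<subseteq> S'" for S' using T(3)[OF that] by simp
    fix t assume "t \<in> tetrahedra C" "T = convex hull t"
    then show thesis using that T(2) by blast
  qed
qed

text \<open>The simplex \<open>{v}\<close> is a face of a tetrahedron containing it, and one-point
  faces are extreme points.\<close>

lemma vertex_in_tetrahedron:
  assumes C: "triangulates C M" and M: "closed_connected_3_manifold M" and v: "v \<in> vertices C"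
  obtains t where "t \<in> tetrahedra C" "v \<in> t"
proof -
  obtain t where t: "t \<in> tetrahedra C" "{v} \<subseteq> convex hull t"
    using subset_tetrahedron[OF C M, of "{v}"] v by (auto simp: vertices_def)
  then have ind: "\<not> affine_dependent t" and "convex hull t \<in> C" by (auto simp: tetrahedra_def)
  then have "{v} \<inter> convex hull t face_of convex hull t"
    using C v unfolding triangulates_def simplicial_complex_def vertices_def by (metis Int_commute mem_Collect_eq)
  then have "{v} face_of convex hull t" using t(2) by (simp add: Int_absorb2)
  then have "v \<in> t"
    using extreme_point_of_convex_hull_affine_independent[OF ind] by (simp add: face_of_singleton)
  then show thesis using that t(1) by blast
qed

text \<open>The unions of the tetrahedra with and without \<open>P\<close> are closed and cover a
  connected space. Tetrahedra that meet share a vertex, so \<open>step\<close> makes the unions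
  disjoint and one of them must be empty.\<close>

lemma tetrahedra_connected:
  assumes C: "triangulates C M" and M: "closed_connected_3_manifold M"
    and t0: "t0 \<in> tetrahedra C" "P t0"
    and step: "\<And>t t'. \<lbrakk>t \<in> tetrahedra C; t' \<in> tetrahedra C; P t; t \<inter> t' \<noteq> {}\<rbrakk> \<Longrightarrow> P t'"
    and t: "t \<in> tetrahedra C"
  shows "P t"
proof (rule ccontr)
  assume nP: "\<not> P t"
  have sc: "simplicial_complex C" and "top_of_set (\<Union>C) homeomorphic_space M"
    using C by (auto simp: triangulates_def)
  moreover have "connected_space M" using M by (simp add: closed_connected_3_manifold_def)
  ultimately have "connected_space (top_of_set (\<Union>C))" by (simp add: homeomorphic_connected_space)
  then have "connected (\<Union>C)"
    by (simp flip: connectedin_iff_connected add: connectedin_def)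
  define A where "A = (\<Union>s \<in> {s \<in> tetrahedra C. P s}. convex hull s)"
  define B where "B = (\<Union>s \<in> {s \<in> tetrahedra C. \<not> P s}. convex hull s)"
  have fin: "finite (tetrahedra C)" by (rule finite_tetrahedra[OF sc])
  have cl: "closed (convex hull s)" if "s \<in> tetrahedra C" for s
    using that by (intro compact_imp_closed finite_imp_compact_convex_hull)
      (auto simp: tetrahedra_def intro: aff_independent_finite)
  have "closed A" "closed B"
    unfolding A_def B_def using fin cl by auto
  moreover have "A \<inter> B = {}"
  proof (rule equals0I)
    fix x assume "x \<in> A \<inter> B"
    then obtain s s' where s: "s \<in> tetrahedra C" "P s" "s' \<in> tetrahedra C" "\<not> P s'"
      and "x \<in> convex hull s" "x \<in> convex hull s'"
      by (auto simp: A_def B_def)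
    then have "convex hull s \<inter> convex hull s' \<noteq> {}" by blast
    then have "s \<inter> s' \<noteq> {}" by (rule tetrahedra_meet[OF sc s(1,3)])
    then show False using step[OF s(1,3,2)] s(4) by simp
  qed
  moreover have "\<Union>C \<subseteq> A \<union> B"
  proof
    fix x assume "x \<in> \<Union>C"
    then obtain S where S: "S \<in> C" "x \<in> S" by blast
    then obtain s where "s \<in> tetrahedra C" "S \<subseteq> convex hull s"
      using subset_tetrahedron[OF C M, of S] by blast
    then show "x \<in> A \<union> B" using S by (auto simp: A_def B_def)
  qed
  moreover have "A \<inter> \<Union>C \<noteq> {}" "B \<inter> \<Union>C \<noteq> {}"
  proof -
    have "\<exists>x. x \<in> convex hull s \<and> x \<in> \<Union>C" if "s \<in> tetrahedra C" for s
    proof -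
      have "convex hull s \<noteq> {}" "convex hull s \<in> C" using that by (auto simp: tetrahedra_def)
      then show ?thesis by blast
    qed
    from this[OF t0(1)] this[OF t] show "A \<inter> \<Union>C \<noteq> {}" "B \<inter> \<Union>C \<noteq> {}"
      using t0 t nP by (auto simp: A_def B_def)
  qed
  ultimately show False using \<open>connected (\<Union>C)\<close> unfolding connected_closed by blast
qed

section \<open>Rigidity\<close>

text \<open>The difference of powers has the sign of \<open>\<alpha> * (y - x)\<close> and
  \<open>b - a\<close> that of \<open>y - x\<close>, so the product takes the sign of
  \<open>\<alpha> * R\<close> unless the points coincide.\<close>

lemma curvature_terms_nonpos:
  fixes \<alpha> R :: real
  assumes "\<alpha> * R \<le> 0" "x > 0" "y > 0" "a < b \<longleftrightarrow> x < y" "b < a \<longleftrightarrow> y < x"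
  shows "R * (y powr \<alpha> - x powr \<alpha>) * (b - a) \<le> 0"
    and "\<lbrakk>\<alpha> * R \<noteq> 0; R * (y powr \<alpha> - x powr \<alpha>) * (b - a) = 0\<rbrakk> \<Longrightarrow> a = b"
proof -
  have main: "R * (y powr \<alpha> - x powr \<alpha>) * (b - a) \<le> 0 \<and>
    (\<alpha> * R \<noteq> 0 \<longrightarrow> a \<noteq> b \<longrightarrow> R * (y powr \<alpha> - x powr \<alpha>) * (b - a) \<noteq> 0)"
    if "x > 0" "y > 0" "a < b \<longleftrightarrow> x < y" "b < a \<longleftrightarrow> y < x" "\<not> b < a" for a b x y :: real
  proof (cases "a < b")
    case True
    then have xy: "x < y" using that by simp
    consider "\<alpha> = 0" | "\<alpha> > 0" "R \<le> 0" | "\<alpha> < 0" "R \<ge> 0"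
      using assms(1) by (fastforce simp: mult_le_0_iff)
    then show ?thesis
    proof cases
      case 1
      then show ?thesis using that by simp
    next
      case 2
      then have "x powr \<alpha> < y powr \<alpha>" using xy that by (intro powr_less_mono2) auto
      then show ?thesis using 2 True by (auto simp: mult_nonpos_nonneg)
    next
      case 3
      then have "y powr \<alpha> < x powr \<alpha>" using xy that by (intro powr_less_mono2_neg) auto
      moreover from this have "R * (y powr \<alpha> - x powr \<alpha>) \<le> 0"
        using 3 by (intro mult_nonneg_nonpos) auto
      ultimately show ?thesis using True by (auto intro: mult_nonpos_nonneg)
    qed
  qed (use that in auto)
  have sym: "R * (y powr \<alpha> - x powr \<alpha>) * (b - a) = R * (x powr \<alpha> - y powr \<alpha>) * (a - b)"
    by (simp add: algebra_simps)
  have "R * (y powr \<alpha> - x powr \<alpha>) * (b - a) \<le> 0 \<and>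
    (\<alpha> * R \<noteq> 0 \<longrightarrow> a \<noteq> b \<longrightarrow> R * (y powr \<alpha> - x powr \<alpha>) * (b - a) \<noteq> 0)"
  proof (cases "b < a")
    case True
    then have "R * (x powr \<alpha> - y powr \<alpha>) * (a - b) \<le> 0 \<and>
      (\<alpha> * R \<noteq> 0 \<longrightarrow> b \<noteq> a \<longrightarrow> R * (x powr \<alpha> - y powr \<alpha>) * (a - b) \<noteq> 0)"
      using assms by (intro main) auto
    then show ?thesis unfolding sym by blast
  next
    case False
    then show ?thesis using main[of x y a b] assms by blast
  qed
  then show "R * (y powr \<alpha> - x powr \<alpha>) * (b - a) \<le> 0"
    and "\<lbrakk>\<alpha> * R \<noteq> 0; R * (y powr \<alpha> - x powr \<alpha>) * (b - a) = 0\<rbrakk> \<Longrightarrow> a = b"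
    by blast+
qed

text \<open>Double counting of incident vertices and tetrahedra: the sum of the terms
  \<open>f v\<close>, each nonpositive, is minus the sum of the tetrahedral terms, also nonpositive.
  Hence every term vanishes. \<open>s\<close> covers both normalisations of the curvature.\<close>

lemma equal_curvature_rigidity:
  fixes A A' :: "'v set \<Rightarrow> 'v \<Rightarrow> real" and r r' R :: "'v \<Rightarrow> real"
  assumes fin: "finite V" "finite T" and TV: "\<And>t. t \<in> T \<Longrightarrow> t \<subseteq> V"
    and mono: "\<And>t. t \<in> T \<Longrightarrow> (\<Sum>v\<in>t. (A' t v - A t v) * (r' v - r v)) \<le> 0"
    and s: "\<And>x. x > 0 \<Longrightarrow> s x > (0::real)" "\<And>x y. \<lbrakk>x > 0; y > 0\<rbrakk> \<Longrightarrow> x < y \<longleftrightarrow> s x < s y"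
    and pos: "\<And>v. v \<in> V \<Longrightarrow> r v > 0" "\<And>v. v \<in> V \<Longrightarrow> r' v > 0"
    and R: "\<And>v. v \<in> V \<Longrightarrow> \<alpha> * R v \<le> 0"
    and K: "\<And>v. v \<in> V \<Longrightarrow> (4 * pi - (\<Sum>t \<in> {t \<in> T. v \<in> t}. A t v)) / s (r v) powr \<alpha> = R v"
    and K': "\<And>v. v \<in> V \<Longrightarrow> (4 * pi - (\<Sum>t \<in> {t \<in> T. v \<in> t}. A' t v)) / s (r' v) powr \<alpha> = R v"
  shows "t \<in> T \<Longrightarrow> (\<Sum>v\<in>t. (A' t v - A t v) * (r' v - r v)) = 0"
    and "\<lbrakk>v \<in> V; \<alpha> * R v \<noteq> 0\<rbrakk> \<Longrightarrow> r' v = r v"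
proof -
  let ?D = "\<lambda>t v. (A' t v - A t v) * (r' v - r v)"
  \<comment> \<open>Since curvature is \<open>R v\<close> times the power of \<open>s\<close>, this
    is the change of curvature times the change of radius.\<close>
  define f where "f v = R v * (s (r' v) powr \<alpha> - s (r v) powr \<alpha>) * (r' v - r v)" for v
  have f: "f v = - (\<Sum>t\<in>{t \<in> T. v \<in> t}. ?D t v)" if "v \<in> V" for v
  proof -
    have "s (r v) powr \<alpha> \<noteq> 0" "s (r' v) powr \<alpha> \<noteq> 0" using s(1) pos that by (simp_all add: less_imp_neq[THEN not_sym])
    then have "R v * s (r v) powr \<alpha> = 4 * pi - (\<Sum>t \<in> {t \<in> T. v \<in> t}. A t v)"
      "R v * s (r' v) powr \<alpha> = 4 * pi - (\<Sum>t \<in> {t \<in> T. v \<in> t}. A' t v)"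
      using K[OF that] K'[OF that] by (simp_all add: field_simps)
    then have "R v * (s (r' v) powr \<alpha> - s (r v) powr \<alpha>) =
        - ((\<Sum>t \<in> {t \<in> T. v \<in> t}. A' t v) - (\<Sum>t \<in> {t \<in> T. v \<in> t}. A t v))"
      by (simp add: right_diff_distrib)
    then show ?thesis
      unfolding f_def sum_distrib_right[symmetric] sum_subtractf by (simp only: minus_mult_left)
  qed
  have tV: "{v \<in> V. v \<in> t} = t" if "t \<in> T" for t using TV[OF that] by auto
  have "(\<Sum>v\<in>V. f v) = - (\<Sum>v\<in>V. \<Sum>t\<in>{t \<in> T. v \<in> t}. ?D t v)" by (simp add: f sum_negf)
  also have "(\<Sum>v\<in>V. \<Sum>t\<in>{t \<in> T. v \<in> t}. ?D t v) = (\<Sum>t\<in>T. \<Sum>v\<in>{v \<in> V. v \<in> t}. ?D t v)"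
    by (rule sum.swap_restrict[OF fin])
  also have "\<dots> = (\<Sum>t\<in>T. \<Sum>v\<in>t. ?D t v)" by (intro sum.cong refl) (simp add: tV)
  finally have eq: "(\<Sum>v\<in>V. f v) = - (\<Sum>t\<in>T. \<Sum>v\<in>t. ?D t v)" .
  have s': "r v < r' v \<longleftrightarrow> s (r v) < s (r' v)" "r' v < r v \<longleftrightarrow> s (r' v) < s (r v)" if "v \<in> V" for v
    using s(2) pos[OF that] by auto
  have f_le: "f v \<le> 0" if "v \<in> V" for v
    unfolding f_def using R[OF that] s(1)[OF pos(1)[OF that]] s(1)[OF pos(2)[OF that]] s'[OF that]
    by (rule curvature_terms_nonpos(1))
  have "(\<Sum>v\<in>V. f v) \<le> 0" using f_le by (rule sum_nonpos)
  moreover have "(\<Sum>t\<in>T. \<Sum>v\<in>t. ?D t v) \<le> 0" using mono by (rule sum_nonpos)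
  ultimately have 0: "(\<Sum>v\<in>V. f v) = 0" "(\<Sum>t\<in>T. \<Sum>v\<in>t. ?D t v) = 0" using eq by auto
  show "(\<Sum>v\<in>t. ?D t v) = 0" if "t \<in> T"
    using 0(2) mono that fin(2) sum_nonneg_eq_0_iff[of T "\<lambda>t. - (\<Sum>v\<in>t. ?D t v)"] by (simp add: sum_negf)
  show "r' v = r v" if "v \<in> V" "\<alpha> * R v \<noteq> 0"
  proof -
    have "f v = 0" using 0(1) f_le that(1) fin(1) sum_nonneg_eq_0_iff[of V "\<lambda>v. - f v"] by (simp add: sum_negf)
    then show ?thesis
      using curvature_terms_nonpos(2)[OF R[OF that(1)] s(1)[OF pos(1)[OF that(1)]]
          s(1)[OF pos(2)[OF that(1)]] s'[OF that(1)] that(2)]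
      unfolding f_def by metis
  qed
qed

lemma euclidean_rigidity:
  assumes C: "triangulates C M" and M: "closed_connected_3_manifold M"
    and r: "euclidean_sphere_packing C r" "euclidean_sphere_packing C r'"
    and curv: "\<And>v. v \<in> vertices C \<Longrightarrow> euclidean_alpha_curvature C \<alpha> r v = R v"
      "\<And>v. v \<in> vertices C \<Longrightarrow> euclidean_alpha_curvature C \<alpha> r' v = R v"
    and R: "\<And>v. v \<in> vertices C \<Longrightarrow> \<alpha> * R v \<le> 0"
  shows "\<exists>c>0. \<forall>v \<in> vertices C. r' v = c * r v"
    and "\<lbrakk>v \<in> vertices C; \<alpha> * R v \<noteq> 0\<rbrakk> \<Longrightarrow> r' v = r v"
proof -
  have sc: "simplicial_complex C" using C by (simp add: triangulates_def)
  have pos: "r v > 0" "r' v > 0" if "v \<in> vertices C" for v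
    using r that by (auto simp: euclidean_sphere_packing_def)
  note tV = tetrahedron_vertex[OF sc]
  note fin = finite_vertices[OF sc] finite_tetrahedra[OF sc]
  have t4: "card t = 4" if "t \<in> tetrahedra C" for t using that by (simp add: tetrahedra_def)
  have tetpos: "r v > 0" "r' v > 0" if "t \<in> tetrahedra C" "v \<in> t" for t v using pos tV that by blast+
  have tet: "(\<Sum>v\<in>t. (euclidean_solid_angle t (edge_length r') v - euclidean_solid_angle t (edge_length r) v)
        * (r' v - r v)) \<le> 0"
    "(\<Sum>v\<in>t. (euclidean_solid_angle t (edge_length r') v - euclidean_solid_angle t (edge_length r) v)
        * (r' v - r v)) = 0 \<Longrightarrow> \<exists>c. \<forall>v\<in>t. r' v = c * r v" if t: "t \<in> tetrahedra C" for t
  proof -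
    obtain p p' where p: "euclidean_tetrahedron t (edge_length r) p" "euclidean_tetrahedron t (edge_length r') p'"
      using r t unfolding euclidean_sphere_packing_def by blast
    have pos': "r v > 0" "r' v > 0" if "v \<in> t" for v using tetpos t that by blast+
    note antimono = euclidean_tetrahedron_antimono[OF t4[OF t] p pos']
    show "(\<Sum>v\<in>t. (euclidean_solid_angle t (edge_length r') v - euclidean_solid_angle t (edge_length r) v)
        * (r' v - r v)) \<le> 0"
      by (rule antimono(1))
    show "(\<Sum>v\<in>t. (euclidean_solid_angle t (edge_length r') v - euclidean_solid_angle t (edge_length r) v)
        * (r' v - r v)) = 0 \<Longrightarrow> \<exists>c. \<forall>v\<in>t. r' v = c * r v"
      by (rule antimono(2))
  qed
  have TV: "t \<subseteq> vertices C" if "t \<in> tetrahedra C" for t using tV that by blast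
  note K = curv[unfolded euclidean_alpha_curvature_def euclidean_curvature_def]
  note rigid = equal_curvature_rigidity[where s = "\<lambda>x. x" and V = "vertices C" and T = "tetrahedra C" and
      A = "\<lambda>t. euclidean_solid_angle t (edge_length r)" and A' = "\<lambda>t. euclidean_solid_angle t (edge_length r')"
      and r = r and r' = r' and R = R and \<alpha> = \<alpha>, OF fin]
  show "r' v = r v" if "v \<in> vertices C" "\<alpha> * R v \<noteq> 0"
    by (rule rigid(2)) (fact TV tet(1) pos R K that | simp)+
  have ratio: "\<exists>c. \<forall>v\<in>t. r' v = c * r v" if "t \<in> tetrahedra C" for t
    by (rule tet(2)[OF that], rule rigid(1)) (fact TV tet(1) pos R K that | simp)+
  show "\<exists>c>0. \<forall>v \<in> vertices C. r' v = c * r v"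
  \<comment> \<open>With no vertices any positive factor serves; otherwise the factor is read off
    from one tetrahedron.\<close>
  proof (cases "vertices C = {}")
    case True
    then show ?thesis by (intro exI[of _ 1]) simp
  next
    case False
    then obtain v0 t0 where v0: "v0 \<in> t0" "t0 \<in> tetrahedra C"
      using vertex_in_tetrahedron[OF C M] by (metis ex_in_conv)
    then obtain c where c: "\<forall>v\<in>t0. r' v = c * r v" using ratio by blast
    have "c * r v0 > 0" using c tetpos(2)[OF v0(2,1)] v0(1) by simp
    then have "c > 0" using tetpos(1)[OF v0(2,1)] by (simp add: zero_less_mult_iff)
    moreover have "r' v = c * r v" if v: "v \<in> vertices C" for v
    proof -
      obtain t where t: "t \<in> tetrahedra C" "v \<in> t" using vertex_in_tetrahedron[OF C M v] .
      have "\<forall>v\<in>t. r' v = c * r v"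
      proof (rule tetrahedra_connected[where P = "\<lambda>t. \<forall>v\<in>t. r' v = c * r v", OF C M v0(2) c _ t(1)])
        fix s s'
        assume s: "s \<in> tetrahedra C" "s' \<in> tetrahedra C" "\<forall>v\<in>s. r' v = c * r v" "s \<inter> s' \<noteq> {}"
        then obtain u where u: "u \<in> s" "u \<in> s'" by blast
        obtain c' where c': "\<forall>v\<in>s'. r' v = c' * r v" using ratio[OF s(2)] by blast
        \<comment> \<open>A shared vertex has a positive radius, so the ratios of the two tetrahedra
          agree.\<close>
        then have "c' * r u = c * r u" using s(3) u by metis
        then have "c' = c" using tetpos(1)[OF s(2) u(2)] by simp
        with c' show "\<forall>v\<in>s'. r' v = c * r v" by simp
      qed
      then show ?thesis using t(2) by blast
    qed
    ultimately show ?thesis by blast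
  qed
qed

lemma hyperbolic_rigidity:
  assumes C: "triangulates C M" and M: "closed_connected_3_manifold M"
    and r: "hyperbolic_sphere_packing C r" "hyperbolic_sphere_packing C r'"
    and curv: "\<And>v. v \<in> vertices C \<Longrightarrow> hyperbolic_alpha_curvature C \<alpha> r v = R v"
      "\<And>v. v \<in> vertices C \<Longrightarrow> hyperbolic_alpha_curvature C \<alpha> r' v = R v"
    and R: "\<And>v. v \<in> vertices C \<Longrightarrow> \<alpha> * R v \<le> 0"
    and v: "v \<in> vertices C"
  shows "r' v = r v"
proof -
  have sc: "simplicial_complex C" using C by (simp add: triangulates_def)
  have pos: "r v > 0" "r' v > 0" if "v \<in> vertices C" for v
    using r that by (auto simp: hyperbolic_sphere_packing_def)
  note tV = tetrahedron_vertex[OF sc]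
  note fin = finite_vertices[OF sc] finite_tetrahedra[OF sc]
  have t4: "card t = 4" if "t \<in> tetrahedra C" for t using that by (simp add: tetrahedra_def)
  have tetpos: "r v > 0" "r' v > 0" if "t \<in> tetrahedra C" "v \<in> t" for t v using pos tV that by blast+
  have tet: "(\<Sum>v\<in>t. (hyperbolic_solid_angle t (edge_length r') v - hyperbolic_solid_angle t (edge_length r) v)
        * (r' v - r v)) \<le> 0"
    "(\<Sum>v\<in>t. (hyperbolic_solid_angle t (edge_length r') v - hyperbolic_solid_angle t (edge_length r) v)
        * (r' v - r v)) = 0 \<Longrightarrow> \<forall>v\<in>t. r' v = r v" if t: "t \<in> tetrahedra C" for t
  proof -
    obtain p p' where p: "hyperbolic_tetrahedron t (edge_length r) p" "hyperbolic_tetrahedron t (edge_length r') p'"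
      using r t unfolding hyperbolic_sphere_packing_def by blast
    have pos': "r v > 0" "r' v > 0" if "v \<in> t" for v using tetpos t that by blast+
    note antimono = hyperbolic_tetrahedron_antimono[OF t4[OF t] p pos']
    show "(\<Sum>v\<in>t. (hyperbolic_solid_angle t (edge_length r') v - hyperbolic_solid_angle t (edge_length r) v)
        * (r' v - r v)) \<le> 0"
      by (rule antimono(1))
    show "(\<Sum>v\<in>t. (hyperbolic_solid_angle t (edge_length r') v - hyperbolic_solid_angle t (edge_length r) v)
        * (r' v - r v)) = 0 \<Longrightarrow> \<forall>v\<in>t. r' v = r v"
      by (rule antimono(2))
  qed
  have TV: "t \<subseteq> vertices C" if "t \<in> tetrahedra C" for t using tV that by blast
  note K = curv[unfolded hyperbolic_alpha_curvature_def hyperbolic_curvature_def]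
  obtain t where t: "t \<in> tetrahedra C" "v \<in> t" using vertex_in_tetrahedron[OF C M v] .
  \<comment> \<open>Equality in a single tetrahedron at \<open>v\<close> already fixes the radius
    there.\<close>
  have "(\<Sum>v\<in>t. (hyperbolic_solid_angle t (edge_length r') v - hyperbolic_solid_angle t (edge_length r) v)
      * (r' v - r v)) = 0"
    by (rule equal_curvature_rigidity(1)[where s = "\<lambda>x. tanh (x / 2)" and V = "vertices C" and T = "tetrahedra C" and
      A = "\<lambda>t. hyperbolic_solid_angle t (edge_length r)" and A' = "\<lambda>t. hyperbolic_solid_angle t (edge_length r')"
      and r = r and r' = r' and R = R and \<alpha> = \<alpha>, OF fin])
     (fact TV tet(1) pos R K t | simp)+
  then show ?thesis using tet(2)[OF t(1)] t(2) by blast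
qed

theorem theorem1p5:
  fixes M :: "'m topology" and C :: "'a::euclidean_space set set"
    and \<alpha> :: real and R :: "'a \<Rightarrow> real"
  assumes "closed_connected_3_manifold M" and "triangulates C M"
  shows
    "((\<forall>v \<in> vertices C. \<alpha> * R v = 0) \<longrightarrow>
       (\<forall>r r'. euclidean_sphere_packing C r \<and> euclidean_sphere_packing C r' \<and>
          (\<forall>v \<in> vertices C. euclidean_alpha_curvature C \<alpha> r v = R v) \<and>
          (\<forall>v \<in> vertices C. euclidean_alpha_curvature C \<alpha> r' v = R v) \<longrightarrow>
          (\<exists>c>0. \<forall>v \<in> vertices C. r' v = c * r v))) \<and>
     ((\<forall>v \<in> vertices C. \<alpha> * R v \<le> 0) \<and> (\<exists>v \<in> vertices C. \<alpha> * R v \<noteq> 0) \<longrightarrow>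
       (\<forall>r r'. euclidean_sphere_packing C r \<and> euclidean_sphere_packing C r' \<and>
          (\<forall>v \<in> vertices C. euclidean_alpha_curvature C \<alpha> r v = R v) \<and>
          (\<forall>v \<in> vertices C. euclidean_alpha_curvature C \<alpha> r' v = R v) \<longrightarrow>
          (\<forall>v \<in> vertices C. r' v = r v))) \<and>
     ((\<forall>v \<in> vertices C. \<alpha> * R v \<le> 0) \<longrightarrow>
       (\<forall>r r'. hyperbolic_sphere_packing C r \<and> hyperbolic_sphere_packing C r' \<and>
          (\<forall>v \<in> vertices C. hyperbolic_alpha_curvature C \<alpha> r v = R v) \<and>
          (\<forall>v \<in> vertices C. hyperbolic_alpha_curvature C \<alpha> r' v = R v) \<longrightarrow>
          (\<forall>v \<in> vertices C. r' v = r v)))"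
proof (intro conjI impI allI)
  note C = assms(2,1)
  fix r r'
  assume R: "\<forall>v \<in> vertices C. \<alpha> * R v = 0"
    and "euclidean_sphere_packing C r \<and> euclidean_sphere_packing C r' \<and>
          (\<forall>v \<in> vertices C. euclidean_alpha_curvature C \<alpha> r v = R v) \<and>
          (\<forall>v \<in> vertices C. euclidean_alpha_curvature C \<alpha> r' v = R v)"
  then show "\<exists>c>0. \<forall>v \<in> vertices C. r' v = c * r v"
    by (intro euclidean_rigidity(1)[OF C, where \<alpha> = \<alpha> and R = R]) auto
next
  note C = assms(2,1)
  fix r r'
  assume R: "(\<forall>v \<in> vertices C. \<alpha> * R v \<le> 0) \<and> (\<exists>v \<in> vertices C. \<alpha> * R v \<noteq> 0)"
    and r: "euclidean_sphere_packing C r \<and> euclidean_sphere_packing C r' \<and>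
          (\<forall>v \<in> vertices C. euclidean_alpha_curvature C \<alpha> r v = R v) \<and>
          (\<forall>v \<in> vertices C. euclidean_alpha_curvature C \<alpha> r' v = R v)"
  then obtain u where u: "u \<in> vertices C" "\<alpha> * R u \<noteq> 0" by blast
  have "\<exists>c>0. \<forall>v \<in> vertices C. r' v = c * r v"
    using R r by (intro euclidean_rigidity(1)[OF C, where \<alpha> = \<alpha> and R = R]) auto
  then obtain c where c: "\<And>v. v \<in> vertices C \<Longrightarrow> r' v = c * r v" by blast
  \<comment> \<open>A vertex where \<open>\<alpha> * R\<close> is nonzero pins the scaling factor to
    1.\<close>
  have "r' u = r u"
    by (rule euclidean_rigidity(2)[OF C, where \<alpha> = \<alpha> and R = R]) (use R r u in blast)+
  moreover have "r u > 0" using r u(1) by (simp add: euclidean_sphere_packing_def)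
  ultimately have "c = 1" using c[OF u(1)] by simp
  then show "\<forall>v \<in> vertices C. r' v = r v" using c by simp
next
  note C = assms(2,1)
  fix r r'
  assume R: "\<forall>v \<in> vertices C. \<alpha> * R v \<le> 0"
    and r: "hyperbolic_sphere_packing C r \<and> hyperbolic_sphere_packing C r' \<and>
          (\<forall>v \<in> vertices C. hyperbolic_alpha_curvature C \<alpha> r v = R v) \<and>
          (\<forall>v \<in> vertices C. hyperbolic_alpha_curvature C \<alpha> r' v = R v)"
  show "\<forall>v \<in> vertices C. r' v = r v"
    by (rule ballI, rule hyperbolic_rigidity[OF C, where \<alpha> = \<alpha> and R = R]) (use R r in blast)+
qed

end
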